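(* Let $x\in[\lambda,\lambda^{-1}]$, let $X=\{z\in(0,\infty):\mathcal{M}(z)=x\}$ and $Y=X\cap(1/3,3]$ (so $X=\bigcup_{k\in\mathbb{Z}}s_k(Y)$). (1) The set of time-invariant Nash equilibria of $\mathrm{Standard}(x)=\mathrm{Trail}(0,1,x,0)$ is exactly the set of maps $\mathbb{Z}\to(0,\infty)^2$, $i\mapsto(b^{\rm st}_i(z),a^{\rm st}_i(z))$, $z\in X$. (2) Equivalently, it is the set of maps $i\mapsto(b^{\rm st}_{i+j}(y),a^{\rm st}_{i+j}(y))$ with $(y,j)$ ranging over $Y\times\mathbb{Z}$.
   Context: Trail of Lost Pennies $\mathrm{Trail}(m_{-\infty},m_\infty,n_{-\infty},n_\infty)$ (with fixed reals $m_*\le m_{-\infty}$, $n_*\le n_\infty$): a strategy is $S:\mathbb{Z}\times\mathbb{N}_+\to[0,\infty)$, time-invariant if independent of the second argument; a time-invariant pair is written $\{(b_i,a_i)\}$ (Mina stakes $b_i$, Maxine $a_i$ at site $i$). Gameplay from $X_0=k$ steps $+1$ with probability $\frac{S_+(X_{t-1},t)}{S_-(X_{t-1},t)+S_+(X_{t-1},t)}$ and $-1$ otherwise ($0/0=1/2$). Payoffs: Mina $P_-=-\sum_t S_-(X_{t-1},t)+T_-$, $T_-=n_{-\infty},n_\infty,n_*$ on $\{\limsup X=-\infty\}$, $\{\liminf X=\infty\}$, and otherwise; Maxine $P_+=-\sum_tS_+(X_{t-1},t)+T_+$, $T_+=m_{-\infty},m_\infty,m_*$ correspondingly. Nash equilibrium: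 no player can increase her expected payoff by switching to any strategy, for every starting point $k\in\mathbb{Z}$. ABMN system on $\mathbb{Z}$: $a_i,b_i\ge0$, $m_i,n_i\in\mathbb{R}$ with $(a_i+b_i)(m_i+a_i)=a_im_{i+1}+b_im_{i-1}$, $(a_i+b_i)(n_i+b_i)=a_in_{i+1}+b_in_{i-1}$, $(a_i+b_i)^2=b_i(m_{i+1}-m_{i-1})$, $(a_i+b_i)^2=a_i(n_{i-1}-n_{i+1})$ for all $i$; positive if all $a_i,b_i>0$. Standard: positive with $\lim_{-\infty}m=0$, $\lim_{\infty}n=0$, $\lim_\infty m=1$; for $z>0$, $(a^{\rm st}(z),b^{\rm st}(z),m^{\rm st}(z),n^{\rm st}(z))$ is the unique standard solution with central ratio $\frac{n_{-1}-n_0}{m_0-m_{-1}}=z$; $\mathcal{M}(z)=\lim_{i\to-\infty}n^{\rm st}_i(z)$. $\lambda$ is the infimum of Mina margins $\frac{n_{-\infty}-n_\infty}{m_\infty-m_{-\infty}}$ of positive solutions. $s(x)=\frac{(\omega-1)^2}{4(\omega+7)}$, $\omega=\sqrt{8x+1}$; $s_0=\mathrm{id}$, $s_{-1}(x)=1/s(1/x)$, $s_i=s\circ s_{i-1}$, $s_{-i}=s_{-1}\circ s_{-(i-1)}$. *)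

theory Defs
  imports "HOL-Probability.Probability"
begin

text \<open>A strategy is a map Z x N -> [0,oo); only the times t >= 1 are used
  (the value at t = 0 is irrelevant). S_minus is Mina's, S_plus Maxine's.\<close>

definition is_strategy :: "(int \<Rightarrow> nat \<Rightarrow> real) \<Rightarrow> bool" where
  "is_strategy S \<longleftrightarrow> (\<forall>i t. 0 \<le> S i t)"

definition step_prob :: "(int \<Rightarrow> nat \<Rightarrow> real) \<Rightarrow> (int \<Rightarrow> nat \<Rightarrow> real) \<Rightarrow> int \<Rightarrow> nat \<Rightarrow> real" where
  "step_prob Sm Sp i t =
     (if Sm i t + Sp i t = 0 then 1/2 else Sp i t / (Sm i t + Sp i t))"

text \<open>Randomness: an i.i.d. sequence of uniform [0,1] variables; the step at
  time t+1 is +1 iff the (t)-th uniform is below the step probability.\<close>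
definition trail_space :: "(nat \<Rightarrow> real) measure" where
  "trail_space = PiM UNIV (\<lambda>_. uniform_measure lborel {0..1::real})"

primrec trail_path ::
  "(int \<Rightarrow> nat \<Rightarrow> real) \<Rightarrow> (int \<Rightarrow> nat \<Rightarrow> real) \<Rightarrow> int \<Rightarrow> (nat \<Rightarrow> real) \<Rightarrow> nat \<Rightarrow> int" where
  "trail_path Sm Sp k \<omega> 0 = k"
| "trail_path Sm Sp k \<omega> (Suc t) =
     trail_path Sm Sp k \<omega> t +
       (if \<omega> t < step_prob Sm Sp (trail_path Sm Sp k \<omega> t) (Suc t) then 1 else -1)"

text \<open>Terminal receipt: tL on {limsup X = -oo} (i.e. X -> -oo), tR on
  {liminf X = +oo} (i.e. X -> +oo), tS otherwise.\<close>
definition terminal :: "real \<Rightarrow> real \<Rightarrow> real \<Rightarrow> (nat \<Rightarrow> int) \<Rightarrow> real" where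
  "terminal tL tR tS X =
     (if filterlim (\<lambda>t. real_of_int (X t)) at_bot sequentially then tL
      else if filterlim (\<lambda>t. real_of_int (X t)) at_top sequentially then tR
      else tS)"

definition expected_payoff ::
  "(int \<Rightarrow> nat \<Rightarrow> real) \<Rightarrow> real \<Rightarrow> real \<Rightarrow> real \<Rightarrow>
   (int \<Rightarrow> nat \<Rightarrow> real) \<Rightarrow> (int \<Rightarrow> nat \<Rightarrow> real) \<Rightarrow> int \<Rightarrow> ereal" where
  "expected_payoff own tL tR tS Sm Sp k =
     ereal (\<integral>\<omega>. terminal tL tR tS (trail_path Sm Sp k \<omega>) \<partial>trail_space)
     - enn2ereal (\<integral>\<^sup>+\<omega>. (\<Sum>t. ennreal (own (trail_path Sm Sp k \<omega> t) (Suc t))) \<partial>trail_space)"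

text \<open>Payoffs in Trail(mL, mR, nL, nR) with fixed reals mS <= mL, nS <= nR
  (mL = m_{-oo}, mR = m_oo, nL = n_{-oo}, nR = n_oo, mS = m_*, nS = n_*).\<close>
definition mina_payoff where
  "mina_payoff mL mR nL nR mS nS Sm Sp k = expected_payoff Sm nL nR nS Sm Sp k"

definition maxine_payoff where
  "maxine_payoff mL mR nL nR mS nS Sm Sp k = expected_payoff Sp mL mR mS Sm Sp k"

definition trail_nash ::
  "real \<Rightarrow> real \<Rightarrow> real \<Rightarrow> real \<Rightarrow> real \<Rightarrow> real \<Rightarrow>
   (int \<Rightarrow> nat \<Rightarrow> real) \<Rightarrow> (int \<Rightarrow> nat \<Rightarrow> real) \<Rightarrow> bool" where
  "trail_nash mL mR nL nR mS nS Sm Sp \<longleftrightarrow>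
     is_strategy Sm \<and> is_strategy Sp \<and>
     (\<forall>k S. is_strategy S \<longrightarrow>
        mina_payoff mL mR nL nR mS nS S Sp k \<le> mina_payoff mL mR nL nR mS nS Sm Sp k) \<and>
     (\<forall>k S. is_strategy S \<longrightarrow>
        maxine_payoff mL mR nL nR mS nS Sm S k \<le> maxine_payoff mL mR nL nR mS nS Sm Sp k)"

definition TI_nash_set ::
  "real \<Rightarrow> real \<Rightarrow> real \<Rightarrow> real \<Rightarrow> real \<Rightarrow> real \<Rightarrow> (int \<Rightarrow> real \<times> real) set" where
  "TI_nash_set mL mR nL nR mS nS =
     {f. trail_nash mL mR nL nR mS nS (\<lambda>i t. fst (f i)) (\<lambda>i t. snd (f i))}"

definition ABMN :: "(int \<Rightarrow> real) \<Rightarrow> (int \<Rightarrow> real) \<Rightarrow> (int \<Rightarrow> real) \<Rightarrow> (int \<Rightarrow> real) \<Rightarrow> bool" where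
  "ABMN a b m n \<longleftrightarrow> (\<forall>i. 0 \<le> a i \<and> 0 \<le> b i \<and>
     (a i + b i) * (m i + a i) = a i * m (i+1) + b i * m (i-1) \<and>
     (a i + b i) * (n i + b i) = a i * n (i+1) + b i * n (i-1) \<and>
     (a i + b i)^2 = b i * (m (i+1) - m (i-1)) \<and>
     (a i + b i)^2 = a i * (n (i-1) - n (i+1)))"

definition ABMN_positive where
  "ABMN_positive a b m n \<longleftrightarrow> ABMN a b m n \<and> (\<forall>i. 0 < a i \<and> 0 < b i)"

definition ABMN_standard where
  "ABMN_standard a b m n \<longleftrightarrow> ABMN_positive a b m n \<and>
     (m \<longlongrightarrow> 0) at_bot \<and> (n \<longlongrightarrow> 0) at_top \<and> (m \<longlongrightarrow> 1) at_top"

text \<open>The (unique, by the paper) standard solution with central ratio z.\<close>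
definition st_sol :: "real \<Rightarrow> (int \<Rightarrow> real) \<times> (int \<Rightarrow> real) \<times> (int \<Rightarrow> real) \<times> (int \<Rightarrow> real)" where
  "st_sol z = (THE q. case q of (a, b, m, n) \<Rightarrow>
      ABMN_standard a b m n \<and> (n (-1) - n 0) / (m 0 - m (-1)) = z)"

definition a_st :: "real \<Rightarrow> int \<Rightarrow> real" where "a_st z = fst (st_sol z)"
definition b_st :: "real \<Rightarrow> int \<Rightarrow> real" where "b_st z = fst (snd (st_sol z))"
definition m_st :: "real \<Rightarrow> int \<Rightarrow> real" where "m_st z = fst (snd (snd (st_sol z)))"
definition n_st :: "real \<Rightarrow> int \<Rightarrow> real" where "n_st z = snd (snd (snd (st_sol z)))"

definition Mcal :: "real \<Rightarrow> real" where
  "Mcal z = Lim at_bot (n_st z)"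

definition lambda_const :: real where
  "lambda_const = Inf {(nL - nR) / (mR - mL) | a b m n mL mR nL nR.
      ABMN_positive a b m n \<and> (m \<longlongrightarrow> mL) at_bot \<and> (m \<longlongrightarrow> mR) at_top \<and>
      (n \<longlongrightarrow> nL) at_bot \<and> (n \<longlongrightarrow> nR) at_top}"

definition s_map :: "real \<Rightarrow> real" where
  "s_map x = (let \<omega> = sqrt (8 * x + 1) in (\<omega> - 1)^2 / (4 * (\<omega> + 7)))"

definition s_minus1 :: "real \<Rightarrow> real" where
  "s_minus1 x = 1 / s_map (1 / x)"

definition s_iter :: "int \<Rightarrow> real \<Rightarrow> real" where
  "s_iter k = (if 0 \<le> k then s_map ^^ nat k else s_minus1 ^^ nat (-k))"

end

theory Submission
  imports Defs
begin

text \<open>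
  At a site of a positive ABMN solution with stakes \<open>a\<close>, \<open>b\<close> the increments of \<open>m\<close> are
  \<open>a\<^sup>2/b\<close> and \<open>2a + b\<close>, those of \<open>n\<close> are \<open>a + 2b\<close> and \<open>b\<^sup>2/a\<close>. Hence the central ratio evolves by
  \<open>s\<close>, which contracts by a factor of at least nine, the solution is determined up to affine
  normalisation by its central ratio, and all increments decay geometrically at both ends; a shift of
  the solution by \<open>j\<close> acts on the central ratio as \<open>s\<^sub>j\<close>.

  If a standard solution is played, \<open>m (X t)\<close> minus the running cost is a martingale, and a
  supermartingale when Maxine deviates, because her equilibrium stake maximises the one-step gain;
  Fatou's lemma bounds every deviation by \<open>m\<close>. The total cost has finite mean and all stakes are
  positive, so no site is visited infinitely often, the walk escapes, and \<open>m\<close> is the payoff.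

  Conversely, one-step deviations from an equilibrium show that at each site either both stakes vanish
  and \<open>m\<close> is nonincreasing there, or both are positive and the ABMN equations hold with \<open>m\<close>
  increasing; so one alternative holds everywhere. If all stakes vanish then both players would gain by
  an arbitrarily cheap bid for certain victory. This uses \<open>x > 0\<close>, that is \<open>\<lambda> > 0\<close>.
\<close>

section \<open>The map \<open>s\<close> and its iterates\<close>

text \<open>Everything at a site is expressed through \<open>\<beta> = b i / a i\<close>. The ratios
  on its two sides are \<open>\<beta> * (1 + 2 * \<beta>)\<close> and
  \<open>\<beta>\<^sup>2 / (2 + \<beta>)\<close>, so in this parameter \<open>s\<close> is rational
  and the square root disappears. The value \<open>\<beta> = 1\<close> gives the pair 3 and 1/3, the
  endpoints of the interval in \<open>Y\<close> and the case of equality in the contraction by nine.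

  A deviation may depend on time and may cost infinitely much. Hence cost and terminal receipt are
  treated apart, the cost in the extended nonnegative reals, and the finite-horizon estimates go by
  induction on the horizon with the strategies left arbitrary, because conditioning on the first
  step shifts them in time.

  In the converse the sequences \<open>m\<close> and \<open>n\<close> are the payoffs themselves, so
  their limits are unknown at first. They are identified last, when the ABMN equations already
  ensure that limits exist and that the walk escapes.

  Since \<open>\<lambda>\<close> is an infimum over all positive solutions, its positivity needs one
  bound for all of them: a shift brings the central ratio into (1/3, 3], where the ranges of
  \<open>m\<close> and \<open>n\<close> are comparable to one single increment.\<close>

lemma s_map_param:
  assumes "0 < \<beta>"
  shows "s_map (\<beta> * (1 + 2 * \<beta>)) = \<beta>\<^sup>2 / (2 + \<beta>)"
proof -
  have "8 * (\<beta> * (1 + 2 * \<beta>)) + 1 = (4 * \<beta> + 1)\<^sup>2"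
    by (simp add: power2_eq_square algebra_simps)
  then have "sqrt (8 * (\<beta> * (1 + 2 * \<beta>)) + 1) = 4 * \<beta> + 1"
    using assms by (metis abs_of_nonneg add_nonneg_nonneg less_imp_le mult_nonneg_nonneg real_sqrt_abs zero_le_numeral zero_le_one)
  then show ?thesis
    using assms unfolding s_map_def Let_def by (simp add: field_simps power2_eq_square)
qed

lemma pos_param:
  fixes x :: real
  assumes "0 < x"
  obtains \<beta> where "0 < \<beta>" "x = \<beta> * (1 + 2 * \<beta>)"
proof
  let ?w = "sqrt (8 * x + 1)"
  have "?w > 1" and sq: "?w * ?w = 8 * x + 1" using assms by simp_all
  then show "0 < (?w - 1) / 4" by simp
  show "x = (?w - 1) / 4 * (1 + 2 * ((?w - 1) / 4))"
    using sq by (simp add: field_simps)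
qed

text \<open>Replacing \<open>\<beta>\<close> by \<open>1/\<beta>\<close> exchanges the two rational
  forms up to reciprocals. This is why conjugating \<open>s_map\<close> with
  \<open>x \<mapsto> 1/x\<close> inverts it.\<close>

lemma s_minus1_param:
  assumes "0 < \<beta>"
  shows "s_minus1 (\<beta>\<^sup>2 / (2 + \<beta>)) = \<beta> * (1 + 2 * \<beta>)"
proof -
  have "1 / (\<beta>\<^sup>2 / (2 + \<beta>)) = (1/\<beta>) * (1 + 2 * (1/\<beta>))"
    using assms by (simp add: field_simps power2_eq_square)
  then have "s_minus1 (\<beta>\<^sup>2 / (2 + \<beta>)) = 1 / ((1/\<beta>)\<^sup>2 / (2 + 1/\<beta>))"
    unfolding s_minus1_def using s_map_param[of "1/\<beta>"] assms by simp
  also have "\<dots> = \<beta> * (1 + 2 * \<beta>)"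
    using assms by (simp add: field_simps power2_eq_square)
  finally show ?thesis .
qed

lemma s_map_pos: "0 < x \<Longrightarrow> 0 < s_map x"
  by (erule pos_param) (simp add: s_map_param)

lemma s_minus1_pos: "0 < x \<Longrightarrow> 0 < s_minus1 x"
  by (simp add: s_minus1_def s_map_pos)

lemma s_minus1_s_map: "0 < x \<Longrightarrow> s_minus1 (s_map x) = x"
  by (erule pos_param) (simp add: s_map_param s_minus1_param)

lemma s_map_s_minus1: "0 < x \<Longrightarrow> s_map (s_minus1 x) = x"
  using s_minus1_s_map[of "1/x"] s_map_pos[of "1/x"] by (simp add: s_minus1_def field_simps)

lemma s_map_le_ninth:
  assumes "0 < x"
  shows "s_map x \<le> x / 9"
proof -
  obtain \<beta> where \<beta>: "0 < \<beta>" "x = \<beta> * (1 + 2 * \<beta>)" using pos_param[OF assms] .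
  \<comment> \<open>The origin of the nine: \<open>(1 + 2 * \<beta>) * (2 + \<beta>) - 9 * \<beta> =
    2 * (\<beta> - 1)\<^sup>2\<close>.\<close>
  have "0 \<le> \<beta> * (2 * (\<beta> - 1)\<^sup>2)" using \<beta> by simp
  then have "9 * \<beta>\<^sup>2 \<le> \<beta> * (1 + 2 * \<beta>) * (2 + \<beta>)"
    by (simp add: power2_eq_square algebra_simps)
  then have "\<beta>\<^sup>2 / (2 + \<beta>) \<le> \<beta> * (1 + 2 * \<beta>) / 9"
    using \<beta>(1) by (simp add: field_simps)
  then show ?thesis unfolding \<beta>(2) s_map_param[OF \<beta>(1)] .
qed

text \<open>Values above 3 have \<open>\<beta> > 1\<close>, and \<open>\<beta> = 1\<close> gives
  exactly 1/3. A decreasing orbit therefore cannot jump over (1/3, 3].\<close>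

lemma s_map_gt_third:
  assumes "3 < x"
  shows "1 / 3 < s_map x"
proof -
  obtain \<beta> where \<beta>: "0 < \<beta>" "x = \<beta> * (1 + 2 * \<beta>)" using pos_param[of x] assms by auto
  have "1 < \<beta>"
  proof (rule ccontr)
    assume "\<not> 1 < \<beta>"
    then have "\<beta> * (1 + 2 * \<beta>) \<le> 1 * (1 + 2 * 1)" using \<beta> by (intro mult_mono) auto
    then show False using assms \<beta> by simp
  qed
  then have "2 + \<beta> < 3 * \<beta>\<^sup>2" using mult_strict_right_mono[of 1 \<beta> \<beta>] unfolding power2_eq_square by linarith
  then have "1 / 3 < \<beta>\<^sup>2 / (2 + \<beta>)" using \<beta>(1) by (simp add: field_simps)
  then show ?thesis unfolding \<beta>(2) s_map_param[OF \<beta>(1)] .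
qed

lemma s_iter_0 [simp]: "s_iter 0 z = z"
  by (simp add: s_iter_def)

lemma s_iter_pos:
  assumes "0 < z"
  shows "0 < s_iter i z"
proof -
  have "0 < (s_map ^^ k) z" "0 < (s_minus1 ^^ k) z" for k
    using assms by (induction k) (auto simp: s_map_pos s_minus1_pos)
  then show ?thesis by (simp add: s_iter_def)
qed

lemma s_iter_plus_one:
  assumes "0 < z"
  shows "s_iter (i + 1) z = s_map (s_iter i z)"
proof (cases "0 \<le> i")
  case True
  then have "nat (i + 1) = Suc (nat i)" by simp
  then show ?thesis using True by (simp add: s_iter_def)
next
  case False
  then have eq: "nat (- i) = Suc (nat (- (i + 1)))" by simp
  have *: "s_iter (i + 1) z = (s_minus1 ^^ nat (- (i + 1))) z"
    using False by (cases "i = -1") (auto simp: s_iter_def)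
  have "s_iter i z = s_minus1 (s_iter (i + 1) z)"
    using False eq * by (simp add: s_iter_def)
  then show ?thesis using s_map_s_minus1 s_iter_pos[OF assms] by simp
qed

text \<open>Backward steps are forced because \<open>s_minus1\<close> undoes \<open>s_map\<close> on
  positive numbers. The lemma recognises as orbits both the ratios of a solution and shifted
  orbits.\<close>

lemma s_iter_unique:
  assumes pos: "\<And>i. 0 < \<phi> i" and step: "\<And>i. \<phi> (i + 1) = s_map (\<phi> i)"
  shows "\<phi> i = s_iter i (\<phi> 0)"
proof (induction i rule: int_induct[where k = 0])
  case (step1 i)
  then show ?case using s_iter_plus_one[OF pos[of 0]] step by simp
next
  case (step2 i)
  have "\<phi> (i - 1) = s_minus1 (\<phi> i)"
    using step[of "i - 1"] s_minus1_s_map[OF pos[of "i - 1"]] by simp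
  moreover have "s_iter (i - 1) (\<phi> 0) = s_minus1 (s_iter i (\<phi> 0))"
    using s_iter_plus_one[OF pos[of 0], of "i - 1"]
      s_minus1_s_map[OF s_iter_pos[OF pos[of 0]], of "i - 1"] by simp
  ultimately show ?case using step2 by simp
qed simp

lemma s_iter_add:
  assumes "0 < z"
  shows "s_iter (i + j) z = s_iter i (s_iter j z)"
  using s_iter_unique[of "\<lambda>i. s_iter (i + j) z" i] s_iter_pos[OF assms] s_iter_plus_one[OF assms, of "_ + j"]
  by (simp add: algebra_simps)

text \<open>The base index is any integer, so one bound serves twice: with \<open>i = 0\<close> it
  gives decay to the right, with \<open>i = - int k\<close> growth to the left.\<close>

lemma s_iter_add_nat_le:
  assumes "0 < z"
  shows "s_iter (i + int k) z \<le> s_iter i z / 9 ^ k"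
proof (induction k)
  case (Suc k)
  have "s_iter (i + int (Suc k)) z = s_map (s_iter (i + int k) z)"
    using s_iter_plus_one[OF assms, of "i + int k"] by (simp add: algebra_simps)
  also have "\<dots> \<le> s_iter (i + int k) z / 9" by (intro s_map_le_ninth s_iter_pos assms)
  also have "\<dots> \<le> (s_iter i z / 9 ^ k) / 9" using Suc by (intro divide_right_mono) auto
  finally show ?case by (simp add: field_simps)
qed simp

lemma s_iter_antimono:
  assumes "0 < z" "i \<le> j"
  shows "s_iter j z \<le> s_iter i z"
proof -
  have "s_iter j z \<le> s_iter i z / 9 ^ nat (j - i)"
    using s_iter_add_nat_le[OF assms(1), of i "nat (j - i)"] assms by simp
  also have "\<dots> \<le> s_iter i z / 1"
    using s_iter_pos[OF assms(1)] by (intro divide_left_mono) (auto simp: less_imp_le)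
  finally show ?thesis by simp
qed

lemma s_iter_eventually_small:
  assumes "0 < z" "0 < e"
  obtains K where "s_iter K z \<le> e"
proof -
  obtain k where "z / e < 9 ^ k" using real_arch_pow[of 9 "z / e"] by auto
  then have "z / 9 ^ k \<le> e" using assms by (simp add: field_simps)
  then show ?thesis using that[of "int k"] s_iter_add_nat_le[OF assms(1), of 0 k] by simp
qed

lemma s_iter_eventually_large:
  assumes "0 < z"
  obtains K where "B \<le> s_iter K z"
proof -
  obtain k where "B / z < 9 ^ k" using real_arch_pow[of 9 "B / z"] by auto
  then have "B \<le> z * 9 ^ k" using assms by (simp add: field_simps)
  then show ?thesis using that[of "- int k"] s_iter_add_nat_le[OF assms(1), of "- int k" k]
    by (simp add: field_simps)
qed

text \<open>The orbit is stopped at its first value at most 3; the preceding value exceeds 3, so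
  \<open>s_map_gt_third\<close> applies to it.\<close>

lemma s_iter_fundamental_domain:
  assumes "0 < z"
  obtains i where "s_iter i z \<in> {1/3<..3}"
proof -
  obtain K where K: "s_iter K z \<le> 3" using s_iter_eventually_small[OF assms, of 3] by auto
  \<comment> \<open>Starting at a value of at least 4, hence above 3, ensures that the first
    entrance does not occur at step 0.\<close>
  obtain L where L: "4 \<le> s_iter L z" using s_iter_eventually_large[OF assms] .
  define k where "k = (LEAST k. s_iter (L + int k) z \<le> 3)"
  have "L \<le> K" using K L s_iter_antimono[OF assms, of K L] by linarith
  then have ex: "s_iter (L + int (nat (K - L))) z \<le> 3" using K by simp
  then have k: "s_iter (L + int k) z \<le> 3" unfolding k_def by (rule LeastI)
  then obtain l where l: "k = Suc l" using L by (cases k) auto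
  have "3 < s_iter (L + int l) z"
    using not_less_Least[of l "\<lambda>k. s_iter (L + int k) z \<le> 3"] l k_def by simp
  then have "1/3 < s_iter (L + int k) z"
    using s_map_gt_third[of "s_iter (L + int l) z"] s_iter_plus_one[OF assms, of "L + int l"] l
    by (simp add: algebra_simps)
  with k show ?thesis using that by auto
qed

section \<open>Positive ABMN solutions\<close>



text \<open>The last two equations give the total increments over two steps, and the first two split
  them at the middle site. Indices 0, 1, 2 stand for the sites \<open>i - 1\<close>,
  \<open>i\<close>, \<open>i + 1\<close>. The form is local because the converse applies it before
  positivity is known at every site.\<close>

lemma ABMN_site_iff:
  fixes a b :: real
  assumes "0 < a" "0 < b"
  shows "(a + b) * (m1 + a) = a * m2 + b * m0 \<and> (a + b) * (n1 + b) = a * n2 + b * n0 \<and>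
      (a + b)\<^sup>2 = b * (m2 - m0) \<and> (a + b)\<^sup>2 = a * (n0 - n2) \<longleftrightarrow>
    m1 - m0 = a\<^sup>2 / b \<and> m2 - m1 = 2 * a + b \<and> n0 - n1 = a + 2 * b \<and> n1 - n2 = b\<^sup>2 / a"
    (is "?L \<longleftrightarrow> ?R")
proof
  assume L: ?L
  then have M: "m2 - m0 = (a + b)\<^sup>2 / b" and N: "n0 - n2 = (a + b)\<^sup>2 / a"
    using assms by (auto simp: field_simps)
  have "(a + b) * (m1 - m0) = a * (m2 - m0) - a * (a + b)"
    and "(a + b) * (n1 - n2) = b * (n0 - n2) - b * (a + b)"
    using L by (simp_all add: algebra_simps)
  then have "(a + b) * (m1 - m0) = (a + b) * (a\<^sup>2 / b)" "(a + b) * (n1 - n2) = (a + b) * (b\<^sup>2 / a)"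
    unfolding M N using assms by (simp_all add: field_simps power2_eq_square)
  then have "m1 - m0 = a\<^sup>2 / b" "n1 - n2 = b\<^sup>2 / a"
    unfolding mult_cancel_left using assms by auto
  moreover have "m2 - m1 = (m2 - m0) - (m1 - m0)" "n0 - n1 = (n0 - n2) - (n1 - n2)" by simp_all
  moreover have "(a + b)\<^sup>2 / b - a\<^sup>2 / b = 2 * a + b" "(a + b)\<^sup>2 / a - b\<^sup>2 / a = a + 2 * b"
    using assms by (simp_all add: field_simps power2_eq_square)
  ultimately show ?R unfolding M N by simp
next
  assume R: ?R
  define p q where "p = a\<^sup>2 / b" and "q = b\<^sup>2 / a"
  have p: "b * p = a\<^sup>2" and q: "a * q = b\<^sup>2" using assms by (simp_all add: p_def q_def)
  have m: "m1 = m0 + p" "m2 = m0 + p + 2 * a + b" and n: "n1 = n2 + q" "n0 = n2 + q + a + 2 * b"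
    using R by (auto simp: p_def q_def)
  show ?L
    unfolding m n using p q by (auto simp: algebra_simps power2_eq_square)
qed

lemma ABMN_positive_iff:
  "ABMN_positive a b m n \<longleftrightarrow> (\<forall>i. 0 < a i \<and> 0 < b i \<and>
     m i - m (i - 1) = (a i)\<^sup>2 / b i \<and> m (i + 1) - m i = 2 * a i + b i \<and>
     n (i - 1) - n i = a i + 2 * b i \<and> n i - n (i + 1) = (b i)\<^sup>2 / a i)"
proof -
  have "ABMN_positive a b m n \<longleftrightarrow> (\<forall>i. (0 < a i \<and> 0 < b i) \<and>
     (a i + b i) * (m i + a i) = a i * m (i+1) + b i * m (i-1) \<and>
     (a i + b i) * (n i + b i) = a i * n (i+1) + b i * n (i-1) \<and>
     (a i + b i)\<^sup>2 = b i * (m (i+1) - m (i-1)) \<and>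
     (a i + b i)\<^sup>2 = a i * (n (i-1) - n (i+1)))"
    unfolding ABMN_positive_def ABMN_def by (auto simp: less_imp_le)
  also have "\<dots> \<longleftrightarrow> (\<forall>i. (0 < a i \<and> 0 < b i) \<and>
     m i - m (i - 1) = (a i)\<^sup>2 / b i \<and> m (i + 1) - m i = 2 * a i + b i \<and>
     n (i - 1) - n i = a i + 2 * b i \<and> n i - n (i + 1) = (b i)\<^sup>2 / a i)"
    by (intro all_cong1 conj_cong refl ABMN_site_iff) auto
  finally show ?thesis by (simp add: conj_assoc)
qed

text \<open>At \<open>i = 0\<close> this is the central ratio; at other indices it is the central
  ratio of a shifted solution.\<close>

definition cratio :: "(int \<Rightarrow> real) \<Rightarrow> (int \<Rightarrow> real) \<Rightarrow> int \<Rightarrow> real" where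
  "cratio m n i = (n (i - 1) - n i) / (m i - m (i - 1))"

locale ABMN_pos =
  fixes a b m n :: "int \<Rightarrow> real"
  assumes pos: "ABMN_positive a b m n"
begin

lemma stakes_pos: "0 < a i" "0 < b i"
  using pos by (auto simp: ABMN_positive_iff)

lemma increments:
  "m i - m (i - 1) = (a i)\<^sup>2 / b i" "m (i + 1) - m i = 2 * a i + b i"
  "n (i - 1) - n i = a i + 2 * b i" "n i - n (i + 1) = (b i)\<^sup>2 / a i"
  using pos by (auto simp: ABMN_positive_iff)

lemma m_step: "m i < m (i + 1)" and n_step: "n (i + 1) < n i"
proof -
  have "0 < m (i + 1) - m i" "0 < n i - n (i + 1)"
    unfolding increments using stakes_pos[of i] by (simp_all add: add_pos_pos)
  then show "m i < m (i + 1)" "n (i + 1) < n i" by simp_all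
qed

lemma m_mono: "i \<le> j \<Longrightarrow> m i \<le> m j"
  by (induction j rule: int_ge_induct) (use m_step in \<open>auto intro: less_imp_le order_trans\<close>)

lemma n_antimono: "i \<le> j \<Longrightarrow> n j \<le> n i"
  by (induction j rule: int_ge_induct) (use n_step in \<open>auto intro: less_imp_le order_trans\<close>)

lemma cratio_eq: "cratio m n i = b i / a i * (1 + 2 * (b i / a i))"
  using stakes_pos[of i] by (simp add: cratio_def increments field_simps power2_eq_square)

lemma cratio_pos: "0 < cratio m n i"
  using stakes_pos[of i] by (simp add: cratio_eq add_pos_pos)

text \<open>Adjacent ratios share the site \<open>i\<close>: both are functions of
  \<open>b i / a i\<close>, and these are the two forms that \<open>s_map_param\<close>
  links.\<close>

lemma cratio_plus_one: "cratio m n (i + 1) = s_map (cratio m n i)"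
proof -
  have "cratio m n (i + 1) = ((b i)\<^sup>2 / a i) / (2 * a i + b i)"
    by (simp add: cratio_def increments)
  also have "\<dots> = (b i / a i)\<^sup>2 / (2 + b i / a i)"
    using stakes_pos[of i] by (simp add: field_simps power2_eq_square)
  also have "\<dots> = s_map (cratio m n i)"
    using stakes_pos[of i] by (subst cratio_eq, subst s_map_param) auto
  finally show ?thesis .
qed

lemma cratio_eq_s_iter: "cratio m n i = s_iter i (cratio m n 0)"
  by (rule s_iter_unique) (simp_all add: cratio_pos cratio_plus_one)

lemma beta_le_cratio: "b i / a i \<le> cratio m n i"
  using stakes_pos[of i] by (simp add: cratio_eq field_simps)

lemma m_growth: "m (i + 1) - m i = (b i / a i) * (2 + b i / a i) * (m i - m (i - 1))"
  unfolding increments using stakes_pos[of i] by (simp add: field_simps power2_eq_square)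

lemma n_growth: "n i - n (i + 1) = (b i / a i)\<^sup>2 / (1 + 2 * (b i / a i)) * (n (i - 1) - n i)"
proof -
  define c where "c = a i + 2 * b i"
  have "0 < c" "1 + 2 * (b i / a i) = c / a i"
    using stakes_pos[of i] by (simp_all add: c_def field_simps)
  then show ?thesis using stakes_pos[of i]
    unfolding increments c_def[symmetric] by (simp add: field_simps power2_eq_square)
qed

lemma shifted: "ABMN_pos (\<lambda>i. a (i + j)) (\<lambda>i. b (i + j)) (\<lambda>i. m (i + j)) (\<lambda>i. n (i + j))"
proof (unfold_locales, unfold ABMN_positive_iff, intro allI)
  fix i
  show "0 < a (i + j) \<and> 0 < b (i + j) \<and>
     m (i + j) - m (i - 1 + j) = (a (i + j))\<^sup>2 / b (i + j) \<and>
     m (i + 1 + j) - m (i + j) = 2 * a (i + j) + b (i + j) \<and>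
     n (i - 1 + j) - n (i + j) = a (i + j) + 2 * b (i + j) \<and>
     n (i + j) - n (i + 1 + j) = (b (i + j))\<^sup>2 / a (i + j)"
    using stakes_pos[of "i + j"] increments[of "i + j"] by (simp add: algebra_simps)
qed

text \<open>Reversing the line exchanges the players, so each fact about the right end yields one
  about the left end.\<close>

lemma reflected: "ABMN_pos (\<lambda>i. b (- i)) (\<lambda>i. a (- i)) (\<lambda>i. n (- i)) (\<lambda>i. m (- i))"
proof (unfold_locales, unfold ABMN_positive_iff, intro allI)
  fix i
  show "0 < b (- i) \<and> 0 < a (- i) \<and>
     n (- i) - n (- (i - 1)) = (b (- i))\<^sup>2 / a (- i) \<and>
     n (- (i + 1)) - n (- i) = 2 * b (- i) + a (- i) \<and>
     m (- (i - 1)) - m (- i) = b (- i) + 2 * a (- i) \<and>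
     m (- i) - m (- (i + 1)) = (a (- i))\<^sup>2 / b (- i)"
    using stakes_pos[of "- i"] increments[of "- i"] by simp
qed

end

text \<open>The quantity \<open>g j + (g j - g (j - 1))\<close> does not increase: the last
  increment bounds the whole remaining geometric series.\<close>

lemma halving_increments_bound:
  fixes g :: "int \<Rightarrow> real"
  assumes "\<And>i. K \<le> i \<Longrightarrow> g (i + 1) - g i \<le> (g i - g (i - 1)) / 2"
    and "\<And>i. K \<le> i \<Longrightarrow> 0 \<le> g i - g (i - 1)" and "K \<le> j"
  shows "g j \<le> g K + (g K - g (K - 1))"
proof -
  have "g j + (g j - g (j - 1)) \<le> g K + (g K - g (K - 1))"
    using \<open>K \<le> j\<close>
  proof (induction j rule: int_ge_induct)
    case (step i)
    then show ?case using assms(1)[of i] by simp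
  qed simp
  then show ?thesis using assms(2)[OF \<open>K \<le> j\<close>] by simp
qed

lemma int_mono_tendsto_at_top:
  fixes f :: "int \<Rightarrow> real"
  assumes mono: "\<And>i j. i \<le> j \<Longrightarrow> f i \<le> f j" and bd: "\<And>i. f i \<le> B"
  obtains L where "(f \<longlongrightarrow> L) at_top" "\<And>i. f i \<le> L"
proof
  have bdd: "bdd_above (range f)" using bd by (auto intro!: bdd_aboveI)
  then show le: "f i \<le> (SUP i. f i)" for i by (intro cSUP_upper) auto
  show "(f \<longlongrightarrow> (SUP i. f i)) at_top"
  proof (rule order_tendstoI)
    fix y assume "y < (SUP i. f i)"
    then obtain i where "y < f i" using less_cSUP_iff[OF _ bdd] by auto
    then show "\<forall>\<^sub>F i in at_top. y < f i"
      using mono by (auto simp: eventually_at_top_linorder intro: less_le_trans)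
  next
    fix y assume "(SUP i. f i) < y"
    then show "\<forall>\<^sub>F i in at_top. f i < y"
      using le by (intro always_eventually allI) (rule le_less_trans)
  qed
qed

lemma tendsto_at_bot_int_iff:
  "(f \<longlongrightarrow> L) at_bot \<longleftrightarrow> ((\<lambda>i::int. f (- i)) \<longlongrightarrow> L) at_top"
proof -
  have "filterlim (\<lambda>i::int. - i) at_bot at_top"
    unfolding filterlim_at_bot eventually_at_top_linorder
    by (metis minus_le_iff)
  moreover have "filterlim (\<lambda>i::int. - i) at_top at_bot"
    unfolding filterlim_at_top eventually_at_bot_linorder
    by (metis le_minus_iff)
  ultimately show ?thesis
    using filterlim_compose[of f "nhds L" at_bot "\<lambda>i. - i" at_top]
      filterlim_compose[of "\<lambda>i. f (- i)" "nhds L" at_top "\<lambda>i. - i" at_bot] by auto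
qed

section \<open>Boundedness and limits of the value sequences\<close>

context ABMN_pos
begin

lemma bounded_right: "\<exists>B C. \<forall>i. m i \<le> B \<and> C \<le> n i"
proof -
  \<comment> \<open>With \<open>b i / a i\<close> at most 1/8 the growth factors of \<open>m\<close>
    and \<open>n\<close> are at most 17/64 and 1/8, both below 1/2.\<close>
  obtain K where K: "s_iter K (cratio m n 0) \<le> 1/8"
    using s_iter_eventually_small[OF cratio_pos] by (metis zero_less_divide_1_iff zero_less_numeral)
  have beta: "0 < b i / a i" "b i / a i \<le> 1/8" if "K \<le> i" for i
  proof -
    show "0 < b i / a i" using stakes_pos[of i] by simp
    show "b i / a i \<le> 1/8"
      using K beta_le_cratio[of i] cratio_eq_s_iter[of i] s_iter_antimono[OF cratio_pos that, of 0]
      by linarith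
  qed
  have m_half: "m (i + 1) - m i \<le> (m i - m (i - 1)) / 2" if "K \<le> i" for i
  proof -
    have "(b i / a i) * (2 + b i / a i) \<le> 1/8 * (2 + 1/8)"
      using beta[OF that] by (intro mult_mono) auto
    then have "(b i / a i) * (2 + b i / a i) \<le> 1/2" by (rule order_trans) simp
    then show ?thesis unfolding m_growth using m_step[of "i - 1"]
      mult_right_mono[of "(b i / a i) * (2 + b i / a i)" "1/2" "m i - m (i - 1)"] by simp
  qed
  have n_half: "n i - n (i + 1) \<le> (n (i - 1) - n i) / 2" if "K \<le> i" for i
  proof -
    have "(b i / a i) * (b i / a i) \<le> 1/8 * 1" using beta[OF that] by (intro mult_mono) linarith+
    then have "(b i / a i)\<^sup>2 \<le> 1/8" by (simp add: power2_eq_square)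
    then have "(b i / a i)\<^sup>2 / (1 + 2 * (b i / a i)) \<le> (1/8) / 1"
      using beta[OF that] by (intro frac_le) auto
    then have "(b i / a i)\<^sup>2 / (1 + 2 * (b i / a i)) \<le> 1/2" by (rule order_trans) simp
    then show ?thesis unfolding n_growth using n_step[of "i - 1"]
      mult_right_mono[of "(b i / a i)\<^sup>2 / (1 + 2 * (b i / a i))" "1/2" "n (i - 1) - n i"] by simp
  qed
  have "m i \<le> m K + (m K - m (K - 1))" if "K \<le> i" for i
    using that m_mono by (intro halving_increments_bound m_half) auto
  moreover have "- n i \<le> - n K + (- n K - - n (K - 1))" if "K \<le> i" for i
    using that n_antimono n_half by (intro halving_increments_bound[where g = "\<lambda>i. - n i"]) auto
  ultimately have right: "m i \<le> m K + (m K - m (K - 1)) \<and> n K + (n K - n (K - 1)) \<le> n i"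
    if "K \<le> i" for i using that by force
  have "m i \<le> m K + (m K - m (K - 1)) \<and> n K + (n K - n (K - 1)) \<le> n i" for i
    using right[of "max i K"] m_mono[of i "max i K"] n_antimono[of i "max i K"] by simp
  then show ?thesis by blast
qed

lemma bounded_left: "\<exists>B C. \<forall>i. n i \<le> B \<and> C \<le> m i"
proof -
  obtain B C where "\<forall>i. n (- i) \<le> B \<and> C \<le> m (- i)"
    using ABMN_pos.bounded_right[OF reflected] by blast
  then show ?thesis by (metis minus_minus)
qed

lemma limits:
  obtains mL mR nL nR where
    "(m \<longlongrightarrow> mL) at_bot" "(m \<longlongrightarrow> mR) at_top" "(n \<longlongrightarrow> nL) at_bot" "(n \<longlongrightarrow> nR) at_top"
    "\<And>i. mL \<le> m i" "\<And>i. m i \<le> mR" "\<And>i. nR \<le> n i" "\<And>i. n i \<le> nL"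
proof -
  obtain B C B' C' where bd: "\<And>i. m i \<le> B" "\<And>i. C \<le> n i" "\<And>i. n i \<le> B'" "\<And>i. C' \<le> m i"
    using bounded_right bounded_left by blast
  obtain mR where mR: "(m \<longlongrightarrow> mR) at_top" "\<And>i. m i \<le> mR"
    using int_mono_tendsto_at_top[of m B] m_mono bd by metis
  obtain nR where nR: "((\<lambda>i. - n i) \<longlongrightarrow> nR) at_top" "\<And>i. - n i \<le> nR"
    using int_mono_tendsto_at_top[of "\<lambda>i. - n i" "- C"] n_antimono bd by (metis neg_le_iff_le)
  obtain mL where mL: "((\<lambda>i. - m (- i)) \<longlongrightarrow> mL) at_top" "\<And>i. - m (- i) \<le> mL"
    using int_mono_tendsto_at_top[of "\<lambda>i. - m (- i)" "- C'"] m_mono bd by (metis neg_le_iff_le)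
  obtain nL where nL: "((\<lambda>i. n (- i)) \<longlongrightarrow> nL) at_top" "\<And>i. n (- i) \<le> nL"
    using int_mono_tendsto_at_top[of "\<lambda>i. n (- i)" "B'"] n_antimono bd by (metis neg_le_iff_le)
  show ?thesis
  proof (rule that[of "- mL" mR nL "- nR"])
    show "(m \<longlongrightarrow> - mL) at_bot" unfolding tendsto_at_bot_int_iff using tendsto_minus[OF mL(1)] by simp
    show "(n \<longlongrightarrow> nL) at_bot" unfolding tendsto_at_bot_int_iff by (rule nL(1))
    show "(n \<longlongrightarrow> - nR) at_top" using tendsto_minus[OF nR(1)] by simp
    show "- mL \<le> m i" for i using mL(2)[of "- i"] by simp
    show "n i \<le> nL" for i using nL(2)[of "- i"] by simp
    show "- nR \<le> n i" for i using nR(2)[of i] by simp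
  qed (use mR in auto)
qed

text \<open>Monotonicity gives weak bounds at a neighbouring site; one further strict step makes
  them strict.\<close>

lemma limit_bounds:
  "(m \<longlongrightarrow> L) at_bot \<Longrightarrow> L < m i" "(m \<longlongrightarrow> L) at_top \<Longrightarrow> m i < L"
  "(n \<longlongrightarrow> L) at_bot \<Longrightarrow> n i < L" "(n \<longlongrightarrow> L) at_top \<Longrightarrow> L < n i"
proof -
  obtain mL mR nL nR where l:
    "(m \<longlongrightarrow> mL) at_bot" "(m \<longlongrightarrow> mR) at_top" "(n \<longlongrightarrow> nL) at_bot" "(n \<longlongrightarrow> nR) at_top"
    "\<And>i. mL \<le> m i" "\<And>i. m i \<le> mR" "\<And>i. nR \<le> n i" "\<And>i. n i \<le> nL"
    using limits by blast
  have bot: "(at_bot :: int filter) \<noteq> bot" and top: "(at_top :: int filter) \<noteq> bot"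
    by auto
  show "(m \<longlongrightarrow> L) at_bot \<Longrightarrow> L < m i"
    using tendsto_unique[OF bot _ l(1)] l(5)[of "i - 1"] m_step[of "i - 1"] by simp
  show "(m \<longlongrightarrow> L) at_top \<Longrightarrow> m i < L"
    using tendsto_unique[OF top _ l(2)] l(6)[of "i + 1"] m_step[of i] by simp
  show "(n \<longlongrightarrow> L) at_bot \<Longrightarrow> n i < L"
    using tendsto_unique[OF bot _ l(3)] l(8)[of "i - 1"] n_step[of "i - 1"] by simp
  show "(n \<longlongrightarrow> L) at_top \<Longrightarrow> L < n i"
    using tendsto_unique[OF top _ l(4)] l(7)[of "i + 1"] n_step[of i] by simp
qed

end


section \<open>Standard solutions\<close>

text \<open>A recursion along all integers also needs a way back: \<open>g i\<close> picks a
  preimage under \<open>f i\<close>.\<close>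

lemma int_recursion:
  fixes f g :: "int \<Rightarrow> 'a \<Rightarrow> 'a"
  assumes "\<And>i x. f i (g i x) = x"
  obtains X where "X 0 = c" "\<And>i. X (i + 1) = f i (X i)"
proof -
  define X where "X i = (if 0 \<le> i then rec_nat c (\<lambda>k x. f (int k) x) (nat i)
    else rec_nat c (\<lambda>k x. g (- int k - 1) x) (nat (- i)))" for i
  have "X 0 = c" by (simp add: X_def)
  moreover have "X (i + 1) = f i (X i)" for i
  proof (cases "0 \<le> i")
    case True
    then have "nat (i + 1) = Suc (nat i)" by simp
    then show ?thesis using True by (simp add: X_def)
  next
    case False
    then have "nat (- i) = Suc (nat (- (i + 1)))" by simp
    moreover have "X (i + 1) = rec_nat c (\<lambda>k x. g (- int k - 1) x) (nat (- (i + 1)))"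
      using False by (cases "i = -1") (auto simp: X_def)
    moreover have "- int (nat (- (i + 1))) - 1 = i" using False by simp
    ultimately have "X i = g i (X (i + 1))" using False by (simp add: X_def del: int_nat_eq)
    then show ?thesis using assms by simp
  qed
  ultimately show ?thesis using that by blast
qed

text \<open>The orbit of \<open>z\<close> prescribes every \<open>\<beta> i\<close>. The increments
  \<open>D\<close> of \<open>m\<close> then follow from the growth factor
  \<open>\<beta> i * (2 + \<beta> i)\<close>, those of \<open>n\<close> from the ratios, and
  \<open>a\<^sup>2 / b = D\<close> with \<open>b / a = \<beta>\<close> forces
  \<open>a = \<beta> * D\<close> and \<open>b = \<beta>\<^sup>2 * D\<close>.\<close>

lemma ABMN_positive_exists:
  assumes "0 < z"
  obtains a b m n where "ABMN_positive a b m n" "cratio m n 0 = z"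
proof -
  have "\<forall>i. \<exists>\<beta>. 0 < \<beta> \<and> s_iter i z = \<beta> * (1 + 2 * \<beta>)"
    using pos_param s_iter_pos[OF assms] by metis
  then obtain \<beta> where \<beta>: "\<And>i. 0 < \<beta> i" "\<And>i. s_iter i z = \<beta> i * (1 + 2 * \<beta> i)" by metis
  define r where "r i = \<beta> i * (2 + \<beta> i)" for i
  have r: "0 < r i" for i using \<beta>(1)[of i] by (simp add: r_def add_pos_pos)
  have "r i * (x / r i) = x" for i x using r[of i] by simp
  then obtain D where D: "D 0 = 1" "\<And>i. D (i + 1) = r i * D i"
    using int_recursion[of "\<lambda>i x. r i * x" "\<lambda>i x. x / r i" 1] by auto
  have Dpos: "0 < D i" for i
  proof (induction i rule: int_induct[where k = 0])
    case (step1 i)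
    then show ?case using r[of i] D by simp
  next
    case (step2 i)
    then show ?case using r[of "i - 1"] D(2)[of "i - 1"] by (simp add: zero_less_mult_iff)
  qed (simp add: D)
  obtain m where m: "\<And>i. m (i + 1) = m i + D (i + 1)"
    by (rule int_recursion[of "\<lambda>i x. x + D (i + 1)" "\<lambda>i x. x - D (i + 1)" "0::real"], simp, blast)
  obtain n where n: "\<And>i. n (i + 1) = n i - s_iter (i + 1) z * D (i + 1)"
    by (rule int_recursion[of "\<lambda>i x. x - s_iter (i + 1) z * D (i + 1)"
          "\<lambda>i x. x + s_iter (i + 1) z * D (i + 1)" "0::real"], simp, blast)
  have mi: "m i - m (i - 1) = D i" and ni: "n (i - 1) - n i = s_iter i z * D i" for i
    using m[of "i - 1"] n[of "i - 1"] by simp_all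
  have next_ratio: "s_iter (i + 1) z = (\<beta> i)\<^sup>2 / (2 + \<beta> i)" for i
    using s_iter_plus_one[OF assms, of i] s_map_param[OF \<beta>(1)] \<beta>(2)[of i] by simp
  have "ABMN_positive (\<lambda>i. \<beta> i * D i) (\<lambda>i. (\<beta> i)\<^sup>2 * D i) m n"
    unfolding ABMN_positive_iff
  proof (intro allI conjI)
    fix i
    note p = \<beta>(1)[of i] Dpos[of i]
    show "0 < \<beta> i * D i" "0 < (\<beta> i)\<^sup>2 * D i" using p by simp_all
    show "m i - m (i - 1) = (\<beta> i * D i)\<^sup>2 / ((\<beta> i)\<^sup>2 * D i)"
      unfolding mi using p by (simp add: power2_eq_square)
    show "m (i + 1) - m i = 2 * (\<beta> i * D i) + (\<beta> i)\<^sup>2 * D i"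
      using m[of i] D(2)[of i] by (simp add: r_def power2_eq_square algebra_simps)
    show "n (i - 1) - n i = \<beta> i * D i + 2 * ((\<beta> i)\<^sup>2 * D i)"
      unfolding ni \<beta>(2) by (simp add: power2_eq_square algebra_simps)
    have "n i - n (i + 1) = (\<beta> i)\<^sup>2 / (2 + \<beta> i) * (\<beta> i * (2 + \<beta> i) * D i)"
      using ni[of "i + 1"] next_ratio[of i] D(2)[of i] by (simp add: r_def)
    also have "\<dots> = ((\<beta> i)\<^sup>2 * D i)\<^sup>2 / (\<beta> i * D i)"
      using p by (simp add: power2_eq_square)
    finally show "n i - n (i + 1) = ((\<beta> i)\<^sup>2 * D i)\<^sup>2 / (\<beta> i * D i)" .
  qed
  moreover have "cratio m n 0 = z"
    unfolding cratio_def mi ni using Dpos[of 0] by simp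
  ultimately show ?thesis using that by blast
qed

lemma (in ABMN_pos) affine:
  assumes "0 < c"
  shows "ABMN_positive (\<lambda>i. c * a i) (\<lambda>i. c * b i) (\<lambda>i. c * (m i - p)) (\<lambda>i. c * (n i - q))"
  unfolding ABMN_positive_iff
proof (intro allI conjI)
  fix i
  note s = stakes_pos[of i] assms
  have d: "c * (x - y) - c * (w - y) = c * (x - w)" for x y w :: real
    by (simp add: algebra_simps)
  show "0 < c * a i" "0 < c * b i" using s by simp_all
  show "c * (m i - p) - c * (m (i - 1) - p) = (c * a i)\<^sup>2 / (c * b i)"
    unfolding d increments using s by (simp add: power2_eq_square)
  show "c * (m (i + 1) - p) - c * (m i - p) = 2 * (c * a i) + c * b i"
    unfolding d increments by (simp add: algebra_simps)
  show "c * (n (i - 1) - q) - c * (n i - q) = c * a i + 2 * (c * b i)"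
    unfolding d increments by (simp add: algebra_simps)
  show "c * (n i - q) - c * (n (i + 1) - q) = (c * b i)\<^sup>2 / (c * a i)"
    unfolding d increments using s by (simp add: power2_eq_square)
qed

lemma ABMN_standard_exists:
  assumes "0 < z"
  obtains a b m n where "ABMN_standard a b m n" "cratio m n 0 = z"
proof -
  obtain a b m n where pos: "ABMN_positive a b m n" and z: "cratio m n 0 = z"
    using ABMN_positive_exists[OF assms] .
  interpret ABMN_pos a b m n by unfold_locales (rule pos)
  obtain mL mR nR where l: "(m \<longlongrightarrow> mL) at_bot" "(m \<longlongrightarrow> mR) at_top" "(n \<longlongrightarrow> nR) at_top"
    by (rule limits) blast
  define c where "c = 1 / (mR - mL)"
  have "mL < mR" using limit_bounds(1)[OF l(1), of 0] limit_bounds(2)[OF l(2), of 0] by simp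
  then have c: "0 < c" "c * (mR - mL) = 1" by (simp_all add: c_def)
  have "((\<lambda>i. c * (m i - mL)) \<longlongrightarrow> c * (mL - mL)) at_bot"
    "((\<lambda>i. c * (m i - mL)) \<longlongrightarrow> c * (mR - mL)) at_top"
    "((\<lambda>i. c * (n i - nR)) \<longlongrightarrow> c * (nR - nR)) at_top"
    by (intro tendsto_intros l)+
  then have "ABMN_standard (\<lambda>i. c * a i) (\<lambda>i. c * b i) (\<lambda>i. c * (m i - mL)) (\<lambda>i. c * (n i - nR))"
    unfolding ABMN_standard_def using affine[OF c(1)] c(2) by simp
  moreover have "cratio (\<lambda>i. c * (m i - mL)) (\<lambda>i. c * (n i - nR)) 0 = cratio m n 0"
  proof -
    have "cratio (\<lambda>i. c * (m i - mL)) (\<lambda>i. c * (n i - nR)) 0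
      = (c * (n (-1) - n 0)) / (c * (m 0 - m (-1)))"
      by (simp add: cratio_def algebra_simps)
    then show ?thesis using c(1) by (simp add: cratio_def)
  qed
  ultimately show ?thesis using that z by blast
qed

lemma beta_inj:
  fixes \<beta> \<gamma> :: real
  assumes "0 < \<beta>" "0 < \<gamma>" "\<beta> * (1 + 2 * \<beta>) = \<gamma> * (1 + 2 * \<gamma>)"
  shows "\<beta> = \<gamma>"
proof -
  have "(\<beta> - \<gamma>) * (1 + 2 * (\<beta> + \<gamma>)) = 0" using assms(3) by (simp add: algebra_simps)
  then show ?thesis using assms(1,2) by (simp add: add_pos_pos)
qed

text \<open>Equal central ratios give equal \<open>b i / a i\<close> everywhere, so the increments
  of \<open>m\<close> and \<open>m'\<close> are proportional. The limits 0 and 1 make the resulting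
  affine map the identity; then the ratios fix the increments of \<open>n\<close>, and its limit
  fixes the constant.\<close>

lemma ABMN_standard_unique:
  assumes st: "ABMN_standard a b m n" and st': "ABMN_standard a' b' m' n'"
    and eq: "cratio m n 0 = cratio m' n' 0"
  shows "a = a' \<and> b = b' \<and> m = m' \<and> n = n'"
proof -
  interpret S: ABMN_pos a b m n using st by unfold_locales (simp add: ABMN_standard_def)
  interpret T: ABMN_pos a' b' m' n' using st' by unfold_locales (simp add: ABMN_standard_def)
  have l: "(m \<longlongrightarrow> 0) at_bot" "(m \<longlongrightarrow> 1) at_top" "(n \<longlongrightarrow> 0) at_top"
    "(m' \<longlongrightarrow> 0) at_bot" "(m' \<longlongrightarrow> 1) at_top" "(n' \<longlongrightarrow> 0) at_top"
    using st st' by (auto simp: ABMN_standard_def)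
  have cr: "cratio m n i = cratio m' n' i" for i
    using S.cratio_eq_s_iter[of i] T.cratio_eq_s_iter[of i] eq by simp
  have beta: "b i / a i = b' i / a' i" for i
  proof (rule beta_inj)
    show "0 < b i / a i" "0 < b' i / a' i" using S.stakes_pos[of i] T.stakes_pos[of i] by simp_all
    show "b i / a i * (1 + 2 * (b i / a i)) = b' i / a' i * (1 + 2 * (b' i / a' i))"
      using cr[of i] unfolding S.cratio_eq T.cratio_eq .
  qed
  define c where "c = (m' 0 - m' (0 - 1)) / (m 0 - m (0 - 1))"
  have ratio: "m' i - m' (i - 1) = c * (m i - m (i - 1))" for i
  proof (induction i rule: int_induct[where k = 0])
    case base
    show ?case using S.m_step[of "-1"] by (simp add: c_def)
  next
    case (step1 i)
    then show ?case using S.m_growth[of i] T.m_growth[of i] beta[of i] by (simp add: mult.left_commute)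
  next
    case (step2 i)
    define r where "r = b (i - 1) / a (i - 1) * (2 + b (i - 1) / a (i - 1))"
    have "0 < r" using S.stakes_pos[of "i - 1"] by (simp add: r_def add_pos_pos)
    moreover have "m i - m (i - 1) = r * (m (i - 1) - m (i - 1 - 1))"
      "m' i - m' (i - 1) = r * (m' (i - 1) - m' (i - 1 - 1))"
      using S.m_growth[of "i - 1"] T.m_growth[of "i - 1"] beta[of "i - 1"] by (simp_all add: r_def)
    ultimately have "r * (m' (i - 1) - m' (i - 1 - 1)) = r * (c * (m (i - 1) - m (i - 1 - 1)))"
      using step2 by (simp add: mult.left_commute)
    then show ?case using \<open>0 < r\<close> by simp
  qed
  define d where "d = m' 0 - c * m 0"
  have affine: "m' i = c * m i + d" for i
  proof (induction i rule: int_induct[where k = 0])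
    case (step1 i)
    then show ?case using ratio[of "i + 1"] by (simp add: algebra_simps)
  next
    case (step2 i)
    then show ?case using ratio[of i] by (simp add: algebra_simps)
  qed (simp add: d_def)
  have "((\<lambda>i. c * m i + d) \<longlongrightarrow> c * 0 + d) at_bot" "((\<lambda>i. c * m i + d) \<longlongrightarrow> c * 1 + d) at_top"
    by (intro tendsto_intros l)+
  then have "(m' \<longlongrightarrow> c * 0 + d) at_bot" "(m' \<longlongrightarrow> c * 1 + d) at_top"
    unfolding affine[symmetric] .
  then have "c * 0 + d = 0" "c * 1 + d = 1"
    using tendsto_unique[OF _ _ l(4)] tendsto_unique[OF _ _ l(5)] by auto
  then have m_eq: "m' = m" using affine by (intro ext) simp
  have n_inc: "n' (i - 1) - n' i = n (i - 1) - n i" for i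
    using cr[of i] S.m_step[of "i - 1"] unfolding cratio_def m_eq by simp
  define e where "e = n' 0 - n 0"
  have n_aff: "n' i = n i + e" for i
  proof (induction i rule: int_induct[where k = 0])
    case (step1 i)
    then show ?case using n_inc[of "i + 1"] by simp
  next
    case (step2 i)
    then show ?case using n_inc[of i] by simp
  qed (simp add: e_def)
  have "((\<lambda>i. n i + e) \<longlongrightarrow> 0 + e) at_top" by (intro tendsto_intros l)
  then have "(n' \<longlongrightarrow> 0 + e) at_top" unfolding n_aff[symmetric] .
  then have "0 + e = 0" using tendsto_unique[OF _ _ l(6)] by auto
  then have n_eq: "n' = n" using n_aff by (intro ext) simp
  \<comment> \<open>Two increments are linear in the stakes, \<open>2a + b\<close> and
    \<open>a + 2b\<close>, and determine them.\<close>
  have "a i = a' i \<and> b i = b' i" for i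
  proof -
    have "2 * a i + b i = 2 * a' i + b' i" "a i + 2 * b i = a' i + 2 * b' i"
      using S.increments(2,3)[of i] T.increments(2,3)[of i] m_eq n_eq by simp_all
    then show ?thesis by simp
  qed
  then show ?thesis using m_eq n_eq by auto
qed

lemma st_sol_eqI:
  assumes "ABMN_standard a b m n" "cratio m n 0 = z"
  shows "a_st z = a" "b_st z = b" "m_st z = m" "n_st z = n"
proof -
  have "st_sol z = (a, b, m, n)"
    unfolding st_sol_def
  proof (rule the_equality)
    fix q assume "case q of (a, b, m, n) \<Rightarrow> ABMN_standard a b m n \<and> (n (-1) - n 0) / (m 0 - m (-1)) = z"
    then obtain a' b' m' n' where "q = (a', b', m', n')" "ABMN_standard a' b' m' n'"
      "cratio m n 0 = cratio m' n' 0"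
      using assms(2) by (cases q) (auto simp: cratio_def)
    then show "q = (a, b, m, n)" using ABMN_standard_unique[OF assms(1)] by blast
  qed (use assms in \<open>simp add: cratio_def\<close>)
  then show "a_st z = a" "b_st z = b" "m_st z = m" "n_st z = n"
    by (simp_all add: a_st_def b_st_def m_st_def n_st_def)
qed

lemma st_sol_standard:
  assumes "0 < z"
  shows "ABMN_standard (a_st z) (b_st z) (m_st z) (n_st z)" "cratio (m_st z) (n_st z) 0 = z"
proof -
  obtain a b m n where st: "ABMN_standard a b m n" "cratio m n 0 = z"
    using ABMN_standard_exists[OF assms] .
  then show "ABMN_standard (a_st z) (b_st z) (m_st z) (n_st z)" "cratio (m_st z) (n_st z) 0 = z"
    by (simp_all add: st_sol_eqI[OF st])
qed

section \<open>Shifts of standard solutions and the invariance of \<open>Mcal\<close>\<close>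

lemma tendsto_shift_int:
  fixes f :: "int \<Rightarrow> 'a::topological_space"
  shows "(f \<longlongrightarrow> L) at_top \<Longrightarrow> ((\<lambda>i. f (i + j)) \<longlongrightarrow> L) at_top"
    and "(f \<longlongrightarrow> L) at_bot \<Longrightarrow> ((\<lambda>i. f (i + j)) \<longlongrightarrow> L) at_bot"
proof -
  have "filterlim (\<lambda>i::int. i + j) at_top at_top"
    unfolding filterlim_at_top eventually_at_top_linorder by (metis diff_le_eq)
  then show "(f \<longlongrightarrow> L) at_top \<Longrightarrow> ((\<lambda>i. f (i + j)) \<longlongrightarrow> L) at_top"
    by (rule filterlim_compose[rotated])
  have "filterlim (\<lambda>i::int. i + j) at_bot at_bot"
    unfolding filterlim_at_bot eventually_at_bot_linorder by (metis le_diff_eq)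
  then show "(f \<longlongrightarrow> L) at_bot \<Longrightarrow> ((\<lambda>i. f (i + j)) \<longlongrightarrow> L) at_bot"
    by (rule filterlim_compose[rotated])
qed

lemma n_st_tendsto_Mcal:
  assumes "0 < z"
  shows "(n_st z \<longlongrightarrow> Mcal z) at_bot"
proof -
  interpret ABMN_pos "a_st z" "b_st z" "m_st z" "n_st z"
    using st_sol_standard[OF assms] by unfold_locales (simp add: ABMN_standard_def)
  obtain L where "(n_st z \<longlongrightarrow> L) at_bot" by (rule limits) blast
  then show ?thesis unfolding Mcal_def by (metis tendsto_Lim trivial_limit_at_bot_linorder)
qed

lemma st_sol_shift:
  assumes "0 < z"
  shows "a_st (s_iter j z) = (\<lambda>i. a_st z (i + j))" "b_st (s_iter j z) = (\<lambda>i. b_st z (i + j))"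
    "Mcal (s_iter j z) = Mcal z"
proof -
  note st = st_sol_standard[OF assms]
  interpret ABMN_pos "a_st z" "b_st z" "m_st z" "n_st z"
    using st by unfold_locales (simp add: ABMN_standard_def)
  let ?m = "\<lambda>i. m_st z (i + j)" and ?n = "\<lambda>i. n_st z (i + j)"
  have sh: "ABMN_standard (\<lambda>i. a_st z (i + j)) (\<lambda>i. b_st z (i + j)) ?m ?n"
    using st(1) ABMN_pos.pos[OF shifted[of j]] unfolding ABMN_standard_def by (auto intro!: tendsto_shift_int)
  have cr: "cratio ?m ?n 0 = s_iter j z"
    using cratio_eq_s_iter[of j] st(2) by (simp add: cratio_def)
  note eqs = st_sol_eqI[OF sh cr]
  then show "a_st (s_iter j z) = (\<lambda>i. a_st z (i + j))" "b_st (s_iter j z) = (\<lambda>i. b_st z (i + j))"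
    by simp_all
  have "(?n \<longlongrightarrow> Mcal (s_iter j z)) at_bot" "(?n \<longlongrightarrow> Mcal z) at_bot"
    using n_st_tendsto_Mcal[OF s_iter_pos[OF assms], of j] tendsto_shift_int(2)[OF n_st_tendsto_Mcal[OF assms]]
    by (simp_all add: eqs)
  then show "Mcal (s_iter j z) = Mcal z" by (intro tendsto_unique) auto
qed

section \<open>Positivity of \<open>\<lambda>\<close>\<close>

text \<open>All is measured in \<open>D 0\<close>: the range of \<open>m\<close> is at most
  \<open>11 * D 0\<close>, that of \<open>n\<close> at least \<open>D 0 / 3\<close>, whence
  33.\<close>

lemma (in ABMN_pos) margin_ge_normalised:
  assumes lim: "(m \<longlongrightarrow> mL) at_bot" "(m \<longlongrightarrow> mR) at_top" "(n \<longlongrightarrow> nL) at_bot" "(n \<longlongrightarrow> nR) at_top"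
    and fund: "cratio m n 0 \<in> {1/3<..3}"
  shows "1 / 33 \<le> (nL - nR) / (mR - mL)"
proof -
  define \<beta> where "\<beta> i = b i / a i" for i
  define D where "D i = m i - m (i - 1)" for i
  have \<beta>: "0 < \<beta> i" for i using stakes_pos[of i] by (simp add: \<beta>_def)
  have D: "0 < D i" "D (i + 1) = \<beta> i * (2 + \<beta> i) * D i" for i
    using m_step[of "i - 1"] m_growth[of i] by (simp_all add: D_def \<beta>_def)
  have cr: "cratio m n i = \<beta> i * (1 + 2 * \<beta> i)" for i by (simp add: cratio_eq \<beta>_def)
  have cr_anti: "cratio m n j \<le> cratio m n i" if "i \<le> j" for i j
    using s_iter_antimono[OF cratio_pos[of 0] that] cratio_eq_s_iter[of i] cratio_eq_s_iter[of j] by simp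
  have cr_next: "cratio m n (i + 1) \<le> cratio m n i / 9" for i
    unfolding cratio_plus_one by (intro s_map_le_ninth cratio_pos)
  have growth_le: "D (i + 1) \<le> B * (2 + B) * D i" if "\<beta> i \<le> B" for i B
    unfolding D(2) using \<beta>[of i] D(1)[of i] that by (intro mult_mono mult_right_mono) auto
  have "\<beta> 0 \<le> 1"
  proof (rule ccontr)
    assume "\<not> \<beta> 0 \<le> 1"
    then have "1 * (1 + 2 * 1) < \<beta> 0 * (1 + 2 * \<beta> 0)" by (intro mult_strict_mono) auto
    then show False using fund cr[of 0] by simp
  qed
  then have D1: "D 1 \<le> 3 * D 0" using growth_le[of 0 1] by simp
  have bc: "\<beta> i \<le> cratio m n i" for i using beta_le_cratio[of i] by (simp add: \<beta>_def)
  \<comment> \<open>Two contractions by nine starting from at most 3. The bound 1/3 gives the growth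
    factor 7/9, and 1/27 gives one below 1/2.\<close>
  have "cratio m n 1 \<le> 1/3" "cratio m n 2 \<le> 1/27"
    using cr_next[of 0] cr_next[of 1] fund by simp_all
  then have D2: "D 2 \<le> D 1" and small: "2 \<le> i \<Longrightarrow> \<beta> i \<le> 1/27" for i
    using growth_le[of 1 "1/3"] bc[of 1] bc[of i] cr_anti[of 2 i] D(1)[of 1] by auto
  \<comment> \<open>Nine is 3 + 3 + 3: \<open>D 1\<close>, \<open>D 2\<close> and the tail beyond
    site 2 are each at most \<open>3 * D 0\<close>.\<close>
  have "m i \<le> m 0 + 9 * D 0" for i
  proof -
    have "m j \<le> m 2 + (m 2 - m (2 - 1))" if "2 \<le> j" for j
    proof (rule halving_increments_bound[OF _ _ that])
      show "m (i + 1) - m i \<le> (m i - m (i - 1)) / 2" if "2 \<le> i" for i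
        using growth_le[OF small[OF that]] D(1)[of i] by (simp add: D_def)
    qed (use m_mono in auto)
    from this[of "max i 2"] have "m i \<le> m 2 + D 2" using m_mono[of i "max i 2"] by (simp add: D_def)
    moreover have "m 2 = m 0 + D 1 + D 2" by (simp add: D_def)
    ultimately show ?thesis using D1 D2 by simp
  qed
  moreover have "m 0 - 2 * D 0 \<le> m i" for i
  proof -
    \<comment> \<open>Left of site 0 the ratios exceed 3, since otherwise the one at 0 would be at
      most 1/3. Hence increments at least triple towards the right, and the part left of
      \<open>-1\<close> contributes at most one more \<open>D 0\<close>.\<close>
    have large: "1 \<le> \<beta> i" if "i \<le> -1" for i
    proof (rule ccontr)
      assume "\<not> 1 \<le> \<beta> i"
      then have "\<beta> i * (1 + 2 * \<beta> i) \<le> 1 * (1 + 2 * 1)" using \<beta>[of i] by (intro mult_mono) auto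
      then have "cratio m n (-1) \<le> 3" using cr[of i] cr_anti[OF that] by simp
      then have "cratio m n 0 \<le> 1/3" using cr_next[of "-1"] by simp
      then show False using fund by simp
    qed
    have "- m (- j) \<le> - m (- 1) + (- m (- 1) - - m (- (1 - 1)))" if "1 \<le> j" for j
    proof (rule halving_increments_bound[where g = "\<lambda>i. - m (- i)", OF _ _ that])
      fix i :: int assume "1 \<le> i"
      then have "1 \<le> \<beta> (- i)" using large by simp
      then have "1 * (2 + 1) \<le> \<beta> (- i) * (2 + \<beta> (- i))" by (intro mult_mono) auto
      then have "2 * D (- i) \<le> D (- i + 1)"
        unfolding D(2) using D(1)[of "- i"] by (intro mult_right_mono) auto
      then show "- m (- (i + 1)) - - m (- i) \<le> (- m (- i) - - m (- (i - 1))) / 2"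
        by (simp add: D_def)
      show "0 \<le> - m (- i) - - m (- (i - 1))" using m_mono[of "- i" "- (i - 1)"] by simp
    qed
    from this[of "max (- i) 1"] have "m (- 1) - D 0 \<le> m (- max (- i) 1)" by (simp add: D_def)
    also have "\<dots> \<le> m i" by (rule m_mono) auto
    finally show ?thesis by (simp add: D_def)
  qed
  ultimately have "mR \<le> m 0 + 9 * D 0" "m 0 - 2 * D 0 \<le> mL"
    using tendsto_upperbound[OF lim(2), of "m 0 + 9 * D 0"]
      tendsto_lowerbound[OF lim(1), of "m 0 - 2 * D 0"] by auto
  then have "mR - mL \<le> 11 * D 0" by simp
  moreover have "D 0 / 3 \<le> nL - nR"
  proof -
    have "cratio m n 0 * D 0 = n (0 - 1) - n 0"
      using D(1)[of 0] by (simp add: cratio_def D_def)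
    moreover have "1/3 * D 0 \<le> cratio m n 0 * D 0"
      using fund D(1)[of 0] by (intro mult_right_mono) auto
    ultimately show ?thesis
      using limit_bounds(3)[OF lim(3), of "0 - 1"] limit_bounds(4)[OF lim(4), of 0] by simp
  qed
  moreover have "0 < mR - mL"
    using limit_bounds(1)[OF lim(1), of 0] limit_bounds(2)[OF lim(2), of 0] by simp
  ultimately show ?thesis by (simp add: field_simps)
qed

text \<open>A shift leaves all four limits unchanged, so the central ratio may be assumed to lie in
  the fundamental domain.\<close>

lemma (in ABMN_pos) margin_ge:
  assumes lim: "(m \<longlongrightarrow> mL) at_bot" "(m \<longlongrightarrow> mR) at_top" "(n \<longlongrightarrow> nL) at_bot" "(n \<longlongrightarrow> nR) at_top"
  shows "1 / 33 \<le> (nL - nR) / (mR - mL)"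
proof -
  obtain j where j: "s_iter j (cratio m n 0) \<in> {1/3<..3}"
    using s_iter_fundamental_domain[OF cratio_pos] .
  show ?thesis
  proof (rule ABMN_pos.margin_ge_normalised[OF shifted[of j]])
    have "cratio (\<lambda>i. m (i + j)) (\<lambda>i. n (i + j)) 0 = cratio m n j" by (simp add: cratio_def)
    then show "cratio (\<lambda>i. m (i + j)) (\<lambda>i. n (i + j)) 0 \<in> {1/3<..3}"
      using j cratio_eq_s_iter[of j] by simp
  qed (intro tendsto_shift_int lim)+
qed

lemma lambda_const_pos: "0 < lambda_const"
proof -
  obtain a b m n where pos: "ABMN_positive a b m n"
    by (rule ABMN_positive_exists[of 1]) auto
  interpret ABMN_pos a b m n by unfold_locales (rule pos)
  obtain mL mR nL nR where l: "(m \<longlongrightarrow> mL) at_bot" "(m \<longlongrightarrow> mR) at_top"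
    "(n \<longlongrightarrow> nL) at_bot" "(n \<longlongrightarrow> nR) at_top"
    by (rule limits) blast
  have "1 / 33 \<le> lambda_const"
    unfolding lambda_const_def
  proof (rule cInf_greatest)
    show "{(nL - nR) / (mR - mL) | a b m n mL mR nL nR.
      ABMN_positive a b m n \<and> (m \<longlongrightarrow> mL) at_bot \<and> (m \<longlongrightarrow> mR) at_top \<and>
      (n \<longlongrightarrow> nL) at_bot \<and> (n \<longlongrightarrow> nR) at_top} \<noteq> {}"
      using pos l by blast
  qed (blast intro: ABMN_pos.margin_ge ABMN_pos.intro)
  then show ?thesis by simp
qed

section \<open>First-step analysis of the gameplay\<close>

abbreviation unit_uniform :: "real measure" where
  "unit_uniform \<equiv> uniform_measure lborel {0..1}"

abbreviation path_space :: "(nat \<Rightarrow> int) measure" where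
  "path_space \<equiv> PiM UNIV (\<lambda>_. count_space UNIV)"

text \<open>The value of a strategy at time \<open>0\<close> is never used; it is set to that at time \<open>1\<close> so that
  shifting a strategy altered only at time \<open>1\<close> gives back the original one.\<close>

definition tshift :: "(int \<Rightarrow> nat \<Rightarrow> real) \<Rightarrow> int \<Rightarrow> nat \<Rightarrow> real" where
  "tshift S i t = S i (Suc (max t 1))"

definition path_cost :: "(int \<Rightarrow> nat \<Rightarrow> real) \<Rightarrow> (nat \<Rightarrow> int) \<Rightarrow> ennreal" where
  "path_cost own X = (\<Sum>t. ennreal (own (X t) (Suc t)))"

definition exp_cost where
  "exp_cost own Sm Sp k = (\<integral>\<^sup>+\<omega>. path_cost own (trail_path Sm Sp k \<omega>) \<partial>trail_space)"

definition exp_terminal where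
  "exp_terminal tL tR tS Sm Sp k = (\<integral>\<omega>. terminal tL tR tS (trail_path Sm Sp k \<omega>) \<partial>trail_space)"

lemma expected_payoff_eq:
  "expected_payoff own tL tR tS Sm Sp k =
    ereal (exp_terminal tL tR tS Sm Sp k) - enn2ereal (exp_cost own Sm Sp k)"
  by (simp add: expected_payoff_def exp_terminal_def exp_cost_def path_cost_def)

lemma tshift_const [simp]: "tshift (\<lambda>i t. c i) = (\<lambda>i t. c i)"
  by (simp add: tshift_def fun_eq_iff)

lemma is_strategy_tshift [simp]: "is_strategy S \<Longrightarrow> is_strategy (tshift S)"
  by (simp add: is_strategy_def tshift_def)

lemma tshift_Suc [simp]: "tshift S i (Suc t) = S i (Suc (Suc t))"
  by (simp add: tshift_def)

lemma step_prob_tshift: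
  "step_prob (tshift Sm) (tshift Sp) i (Suc t) = step_prob Sm Sp i (Suc (Suc t))"
  by (simp add: step_prob_def)

lemma step_prob_bounds:
  assumes "is_strategy Sm" "is_strategy Sp"
  shows "0 \<le> step_prob Sm Sp i t" "step_prob Sm Sp i t \<le> 1"
proof -
  have "0 \<le> Sm i t" "0 \<le> Sp i t" using assms by (auto simp: is_strategy_def)
  then show "0 \<le> step_prob Sm Sp i t" "step_prob Sm Sp i t \<le> 1"
    by (auto simp: step_prob_def divide_le_eq_1)
qed

section \<open>Measurability and integrability of path functionals\<close>

lemma prob_space_unit_uniform: "prob_space unit_uniform"
  by (intro prob_space_uniform_measure) auto

lemma prob_space_trail: "prob_space trail_space"
  unfolding trail_space_def by (intro prob_space_PiM prob_space_unit_uniform)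

lemma measurable_trail_coordinate: "(\<lambda>\<omega>. \<omega> t) \<in> borel_measurable trail_space"
proof -
  have "(\<lambda>\<omega>. \<omega> t) \<in> measurable trail_space unit_uniform"
    unfolding trail_space_def by (rule measurable_component_singleton) simp
  then show ?thesis by (simp cong: measurable_cong_sets)
qed

lemma measurable_trail_path_coordinate [measurable]:
  "(\<lambda>\<omega>. trail_path Sm Sp k \<omega> t) \<in> measurable trail_space (count_space UNIV)"
proof (induction t)
  case (Suc t)
  have "(\<lambda>\<omega>. i + (if \<omega> t < step_prob Sm Sp i (Suc t) then 1 else -1))
      \<in> measurable trail_space (count_space UNIV)" for i :: int
    using measurable_trail_coordinate[of t] by measurable
  from measurable_compose_countable[OF this Suc] show ?case by (simp only: trail_path.simps)
qed simp

lemma measurable_trail_path [measurable]: "trail_path Sm Sp k \<in> measurable trail_space path_space"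
  by (rule measurable_PiM_single') (auto simp: space_PiM)

lemma measurable_path_fun: "(\<lambda>X. f (X t)) \<in> measurable path_space (count_space UNIV)"
  by (rule measurable_compose[OF measurable_component_singleton]) auto

lemma measurable_path_borel:
  fixes f :: "int \<Rightarrow> 'a::topological_space"
  shows "(\<lambda>X. f (X t)) \<in> borel_measurable path_space"
  by (rule measurable_compose[OF measurable_component_singleton]) auto

text \<open>With integer instead of real levels, divergence is a countable combination of events,
  which yields measurability.\<close>

lemma terminal_alt:
  "terminal tL tR tS X = (if filterlim X at_bot sequentially then tL
      else if filterlim X at_top sequentially then tR else tS)"
proof -
  have "filterlim (\<lambda>t. real_of_int (X t)) at_bot sequentially \<longleftrightarrow> filterlim X at_bot sequentially"
  proof
    assume L: "filterlim (\<lambda>t. real_of_int (X t)) at_bot sequentially"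
    show "filterlim X at_bot sequentially"
      unfolding filterlim_at_bot
    proof
      fix z
      have "\<forall>\<^sub>F t in sequentially. real_of_int (X t) \<le> real_of_int z"
        using L unfolding filterlim_at_bot by blast
      then show "\<forall>\<^sub>F t in sequentially. X t \<le> z" by simp
    qed
  next
    assume R: "filterlim X at_bot sequentially"
    show "filterlim (\<lambda>t. real_of_int (X t)) at_bot sequentially"
      unfolding filterlim_at_bot
    proof
      fix z :: real
      have "\<forall>\<^sub>F t in sequentially. X t \<le> \<lfloor>z\<rfloor>" using R unfolding filterlim_at_bot by blast
      then show "\<forall>\<^sub>F t in sequentially. real_of_int (X t) \<le> z" by eventually_elim linarith
    qed
  qed
  moreover have "filterlim (\<lambda>t. real_of_int (X t)) at_top sequentially \<longleftrightarrow> filterlim X at_top sequentially"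
  proof
    assume L: "filterlim (\<lambda>t. real_of_int (X t)) at_top sequentially"
    show "filterlim X at_top sequentially"
      unfolding filterlim_at_top
    proof
      fix z
      have "\<forall>\<^sub>F t in sequentially. real_of_int z \<le> real_of_int (X t)"
        using L unfolding filterlim_at_top by blast
      then show "\<forall>\<^sub>F t in sequentially. z \<le> X t" by simp
    qed
  next
    assume R: "filterlim X at_top sequentially"
    show "filterlim (\<lambda>t. real_of_int (X t)) at_top sequentially"
      unfolding filterlim_at_top
    proof
      fix z :: real
      have "\<forall>\<^sub>F t in sequentially. \<lceil>z\<rceil> \<le> X t" using R unfolding filterlim_at_top by blast
      then show "\<forall>\<^sub>F t in sequentially. z \<le> real_of_int (X t)" by eventually_elim linarith
    qed
  qed
  ultimately show ?thesis by (simp add: terminal_def)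
qed

lemma measurable_terminal [measurable]: "terminal tL tR tS \<in> borel_measurable path_space"
proof -
  note measurable_path_fun [measurable]
  have [measurable]: "Measurable.pred path_space (\<lambda>X. filterlim X at_bot sequentially)"
    "Measurable.pred path_space (\<lambda>X. filterlim X at_top sequentially)"
    unfolding filterlim_at_bot filterlim_at_top eventually_sequentially by measurable
  show ?thesis unfolding terminal_alt[abs_def] by measurable
qed

lemma measurable_path_cost [measurable]: "path_cost own \<in> borel_measurable path_space"
proof -
  have "(\<lambda>X. ennreal (own (X t) (Suc t))) \<in> borel_measurable path_space" for t
    by (rule measurable_path_borel)
  then show ?thesis unfolding path_cost_def[abs_def] by measurable
qed

lemma terminal_bound: "\<bar>terminal tL tR tS X\<bar> \<le> \<bar>tL\<bar> + \<bar>tR\<bar> + \<bar>tS\<bar>"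
  by (simp add: terminal_def)

lemma integrable_bounded_path_fun:
  fixes F :: "(nat \<Rightarrow> int) \<Rightarrow> real"
  assumes [measurable]: "F \<in> borel_measurable path_space" and "\<And>X. \<bar>F X\<bar> \<le> B"
  shows "integrable trail_space (\<lambda>\<omega>. F (trail_path Sm Sp k \<omega>))"
proof -
  interpret prob_space trail_space by (rule prob_space_trail)
  show ?thesis using assms(2) by (intro integrable_const_bound[where B = B]) auto
qed

lemma integrable_terminal: "integrable trail_space (\<lambda>\<omega>. terminal tL tR tS (trail_path Sm Sp k \<omega>))"
  by (rule integrable_bounded_path_fun) (auto intro: terminal_bound)

section \<open>Conditioning on the first step\<close>

lemma terminal_case_nat: "terminal tL tR tS (case_nat k X) = terminal tL tR tS X"
  unfolding terminal_alt
  using filterlim_sequentially_Suc[of "case_nat k X" at_bot] filterlim_sequentially_Suc[of "case_nat k X" at_top]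
  by simp

lemma path_cost_case_nat:
  "path_cost own (case_nat k X) = ennreal (own k 1) + path_cost (tshift own) X"
  unfolding path_cost_def by (subst suminf_offset[where i = 1]) (auto simp: add.commute)

text \<open>A pathwise Markov property: the first uniform decides the first move, and the remaining
  ones drive a fresh gameplay one unit of time later.\<close>

lemma trail_path_case_nat:
  "trail_path Sm Sp k (case_nat u \<omega>) = case_nat k (trail_path (tshift Sm) (tshift Sp)
     (if u < step_prob Sm Sp k 1 then k + 1 else k - 1) \<omega>)"
proof
  fix t
  have "trail_path Sm Sp k (case_nat u \<omega>) (Suc t) = trail_path (tshift Sm) (tshift Sp)
     (if u < step_prob Sm Sp k 1 then k + 1 else k - 1) \<omega> t" for t
    by (induction t) (simp_all add: step_prob_tshift)
  then show "trail_path Sm Sp k (case_nat u \<omega>) t = case_nat k (trail_path (tshift Sm) (tshift Sp)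
     (if u < step_prob Sm Sp k 1 then k + 1 else k - 1) \<omega>) t"
    by (cases t) simp_all
qed

lemma nn_integral_unit_uniform_split:
  fixes A B :: ennreal
  assumes p: "0 \<le> p" "p \<le> 1"
  shows "(\<integral>\<^sup>+u. A * indicator {..<p} u + B * indicator {p..} u \<partial>unit_uniform)
      = ennreal p * A + ennreal (1 - p) * B"
proof -
  have sets: "{..<p} \<in> sets unit_uniform" "{p..} \<in> sets unit_uniform" by simp_all
  have "{0..1} \<inter> {..<p} = {0..<p}" "{0..1} \<inter> {p..} = {p..1}" using p by auto
  then have em: "emeasure unit_uniform {..<p} = ennreal p" "emeasure unit_uniform {p..} = ennreal (1 - p)"
    using p by (auto simp: divide_ennreal_def)
  have "(\<integral>\<^sup>+u. A * indicator {..<p} u + B * indicator {p..} u \<partial>unit_uniform)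
      = (\<integral>\<^sup>+u. A * indicator {..<p} u \<partial>unit_uniform) + (\<integral>\<^sup>+u. B * indicator {p..} u \<partial>unit_uniform)"
    by (rule nn_integral_add) simp_all
  then show ?thesis
    by (simp only: nn_integral_cmult_indicator[OF sets(1)] nn_integral_cmult_indicator[OF sets(2)] em mult.commute)
qed

text \<open>Prepending an independent uniform to the sequence preserves its law, so Tonelli
  separates the first move. The nonnegative version covers infinite costs.\<close>

lemma nn_integral_first_step:
  fixes F :: "(nat \<Rightarrow> int) \<Rightarrow> ennreal" and k :: int
  assumes [measurable]: "F \<in> borel_measurable path_space"
    and strat: "is_strategy Sm" "is_strategy Sp"
  defines "p \<equiv> step_prob Sm Sp k 1"
  shows "(\<integral>\<^sup>+\<omega>. F (trail_path Sm Sp k \<omega>) \<partial>trail_space) =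
    ennreal p * (\<integral>\<^sup>+\<omega>. F (case_nat k (trail_path (tshift Sm) (tshift Sp) (k + 1) \<omega>)) \<partial>trail_space) +
    ennreal (1 - p) * (\<integral>\<^sup>+\<omega>. F (case_nat k (trail_path (tshift Sm) (tshift Sp) (k - 1) \<omega>)) \<partial>trail_space)"
    (is "?L = _ * ?A + _ * ?B")
proof -
  interpret U: prob_space unit_uniform by (rule prob_space_unit_uniform)
  interpret T: prob_space trail_space by (rule prob_space_trail)
  interpret S: sequence_space unit_uniform by unfold_locales
  have iter: "distr (unit_uniform \<Otimes>\<^sub>M trail_space) trail_space (\<lambda>(s, \<omega>). case_nat s \<omega>) = trail_space"
    unfolding trail_space_def by (rule S.PiM_iter)
  have [measurable]: "(\<lambda>(s, \<omega>). case_nat s \<omega>) \<in> measurable (unit_uniform \<Otimes>\<^sub>M trail_space) trail_space"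
    unfolding trail_space_def by measurable
  have p: "0 \<le> p" "p \<le> 1" using step_prob_bounds[OF strat] by (auto simp: p_def)
  have meas: "(\<lambda>x. F (trail_path Sm Sp k (case x of (s, \<omega>) \<Rightarrow> case_nat s \<omega>)))
      \<in> borel_measurable (unit_uniform \<Otimes>\<^sub>M trail_space)" by measurable
  have "?L = (\<integral>\<^sup>+\<omega>. F (trail_path Sm Sp k \<omega>)
      \<partial>distr (unit_uniform \<Otimes>\<^sub>M trail_space) trail_space (\<lambda>(s, \<omega>). case_nat s \<omega>))"
    by (simp only: iter)
  also have "\<dots> = (\<integral>\<^sup>+x. F (trail_path Sm Sp k (case x of (s, \<omega>) \<Rightarrow> case_nat s \<omega>)) \<partial>(unit_uniform \<Otimes>\<^sub>M trail_space))"
    by (rule nn_integral_distr) measurable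
  also have "\<dots> = (\<integral>\<^sup>+u. \<integral>\<^sup>+\<omega>. F (trail_path Sm Sp k (case_nat u \<omega>)) \<partial>trail_space \<partial>unit_uniform)"
    by (subst T.nn_integral_fst[OF meas, symmetric]) simp
  also have "\<dots> = (\<integral>\<^sup>+u. ?A * indicator {..<p} u + ?B * indicator {p..} u \<partial>unit_uniform)"
    unfolding trail_path_case_nat p_def[symmetric]
    by (rule nn_integral_cong) (simp add: indicator_def)
  also have "\<dots> = ennreal p * ?A + ennreal (1 - p) * ?B" by (rule nn_integral_unit_uniform_split[OF p])
  finally show ?thesis .
qed

text \<open>Adding the bound \<open>B\<close> makes the functional nonnegative; \<open>B\<close>
  cancels since the weights \<open>p\<close> and \<open>1 - p\<close> sum to one.\<close>

lemma integral_first_step: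
  fixes F :: "(nat \<Rightarrow> int) \<Rightarrow> real" and k :: int
  assumes F [measurable]: "F \<in> borel_measurable path_space" and bd: "\<And>X. \<bar>F X\<bar> \<le> B"
    and strat: "is_strategy Sm" "is_strategy Sp"
  defines "p \<equiv> step_prob Sm Sp k 1"
  shows "(\<integral>\<omega>. F (trail_path Sm Sp k \<omega>) \<partial>trail_space) =
    p * (\<integral>\<omega>. F (case_nat k (trail_path (tshift Sm) (tshift Sp) (k + 1) \<omega>)) \<partial>trail_space) +
    (1 - p) * (\<integral>\<omega>. F (case_nat k (trail_path (tshift Sm) (tshift Sp) (k - 1) \<omega>)) \<partial>trail_space)"
proof -
  interpret T: prob_space trail_space by (rule prob_space_trail)
  define F' where "F' X = F (case_nat k X)" for X
  have F' [measurable]: "F' \<in> borel_measurable path_space" unfolding F'_def by measurable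
  have bd': "\<bar>F' X\<bar> \<le> B" for X by (simp add: F'_def bd)
  have pos: "0 \<le> F X + B" "0 \<le> F' X + B" for X using bd[of X] bd'[of X] by auto
  note int [simp] = integrable_bounded_path_fun[OF F bd] integrable_bounded_path_fun[OF F' bd']
  have nn: "(\<integral>\<^sup>+\<omega>. ennreal (F (trail_path Sm Sp j \<omega>) + B) \<partial>trail_space)
      = ennreal ((\<integral>\<omega>. F (trail_path Sm Sp j \<omega>) \<partial>trail_space) + B)"
    "(\<integral>\<^sup>+\<omega>. ennreal (F' (trail_path Sm' Sp' j \<omega>) + B) \<partial>trail_space)
      = ennreal ((\<integral>\<omega>. F' (trail_path Sm' Sp' j \<omega>) \<partial>trail_space) + B)" for j Sm' Sp'
    by (subst nn_integral_eq_integral; simp add: pos T.prob_space)+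
  have p: "0 \<le> p" "p \<le> 1" using step_prob_bounds[OF strat] by (auto simp: p_def)
  let ?A = "\<integral>\<omega>. F' (trail_path (tshift Sm) (tshift Sp) (k + 1) \<omega>) \<partial>trail_space"
  let ?B = "\<integral>\<omega>. F' (trail_path (tshift Sm) (tshift Sp) (k - 1) \<omega>) \<partial>trail_space"
  have nonneg: "0 \<le> (\<integral>\<omega>. F (trail_path Sm Sp k \<omega>) \<partial>trail_space) + B" "0 \<le> ?A + B" "0 \<le> ?B + B"
  proof -
    have "0 \<le> (\<integral>\<omega>. F (trail_path Sm Sp k \<omega>) + B \<partial>trail_space)"
      "0 \<le> (\<integral>\<omega>. F' (trail_path (tshift Sm) (tshift Sp) (k + 1) \<omega>) + B \<partial>trail_space)"
      "0 \<le> (\<integral>\<omega>. F' (trail_path (tshift Sm) (tshift Sp) (k - 1) \<omega>) + B \<partial>trail_space)"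
      by (intro Bochner_Integration.integral_nonneg pos)+
    then show "0 \<le> (\<integral>\<omega>. F (trail_path Sm Sp k \<omega>) \<partial>trail_space) + B" "0 \<le> ?A + B" "0 \<le> ?B + B"
      by (simp_all add: T.prob_space)
  qed
  have "ennreal ((\<integral>\<omega>. F (trail_path Sm Sp k \<omega>) \<partial>trail_space) + B)
     = ennreal p * ennreal (?A + B) + ennreal (1 - p) * ennreal (?B + B)"
    unfolding nn[symmetric] unfolding F'_def p_def
    by (rule nn_integral_first_step[where F = "\<lambda>X. ennreal (F X + B)", OF _ strat]) measurable
  also have "\<dots> = ennreal (p * (?A + B) + (1 - p) * (?B + B))"
    using p nonneg by (simp add: ennreal_mult ennreal_plus)
  finally have "(\<integral>\<omega>. F (trail_path Sm Sp k \<omega>) \<partial>trail_space) + B = p * (?A + B) + (1 - p) * (?B + B)"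
    using p nonneg by (subst (asm) ennreal_inj) auto
  then show ?thesis by (simp add: F'_def algebra_simps)
qed

lemma weighted_const_add:
  fixes c x y :: ennreal
  assumes "0 \<le> p" "p \<le> 1"
  shows "ennreal p * (c + x) + ennreal (1 - p) * (c + y) = c + (ennreal p * x + ennreal (1 - p) * y)"
proof -
  have "ennreal p + ennreal (1 - p) = 1" using assms by (simp flip: ennreal_plus)
  then have "ennreal p * c + ennreal (1 - p) * c = c" by (metis distrib_right mult_1)
  moreover have "ennreal p * (c + x) + ennreal (1 - p) * (c + y)
      = (ennreal p * c + ennreal (1 - p) * c) + (ennreal p * x + ennreal (1 - p) * y)"
    by (simp only: distrib_left distrib_right ac_simps)
  ultimately show ?thesis by simp
qed

lemma exp_cost_first_step:
  assumes "is_strategy Sm" "is_strategy Sp"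
  shows "exp_cost own Sm Sp k = ennreal (own k 1) +
     (ennreal (step_prob Sm Sp k 1) * exp_cost (tshift own) (tshift Sm) (tshift Sp) (k + 1) +
      ennreal (1 - step_prob Sm Sp k 1) * exp_cost (tshift own) (tshift Sm) (tshift Sp) (k - 1))"
proof -
  interpret T: prob_space trail_space by (rule prob_space_trail)
  show ?thesis
    unfolding weighted_const_add[OF step_prob_bounds[OF assms], symmetric]
    unfolding exp_cost_def nn_integral_first_step[OF measurable_path_cost assms] path_cost_case_nat
    by (simp add: nn_integral_add T.emeasure_space_1)
qed

lemma exp_terminal_first_step:
  assumes "is_strategy Sm" "is_strategy Sp"
  shows "exp_terminal tL tR tS Sm Sp k =
      step_prob Sm Sp k 1 * exp_terminal tL tR tS (tshift Sm) (tshift Sp) (k + 1) +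
      (1 - step_prob Sm Sp k 1) * exp_terminal tL tR tS (tshift Sm) (tshift Sp) (k - 1)"
  unfolding exp_terminal_def
  by (simp only: integral_first_step[OF measurable_terminal terminal_bound assms] terminal_case_nat)


section \<open>Martingale estimates\<close>

definition exp_at :: "(int \<Rightarrow> real) \<Rightarrow> nat \<Rightarrow> (int \<Rightarrow> nat \<Rightarrow> real) \<Rightarrow> (int \<Rightarrow> nat \<Rightarrow> real) \<Rightarrow> int \<Rightarrow> ennreal" where
  "exp_at v T Sm Sp k = (\<integral>\<^sup>+\<omega>. ennreal (v (trail_path Sm Sp k \<omega> T)) \<partial>trail_space)"

definition exp_cost_upto where
  "exp_cost_upto own T Sm Sp k =
    (\<integral>\<^sup>+\<omega>. (\<Sum>s<T. ennreal (own (trail_path Sm Sp k \<omega> s) (Suc s))) \<partial>trail_space)"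

lemma exp_at_Suc:
  assumes "is_strategy Sm" "is_strategy Sp"
  shows "exp_at v (Suc T) Sm Sp k =
      ennreal (step_prob Sm Sp k 1) * exp_at v T (tshift Sm) (tshift Sp) (k + 1) +
      ennreal (1 - step_prob Sm Sp k 1) * exp_at v T (tshift Sm) (tshift Sp) (k - 1)"
proof -
  have "(\<lambda>X. ennreal (v (X (Suc T)))) \<in> borel_measurable path_space"
    by (rule measurable_path_borel)
  from nn_integral_first_step[OF this assms, of k] show ?thesis by (simp add: exp_at_def)
qed

lemma measurable_cost_upto:
  "(\<lambda>X. \<Sum>s<T. ennreal (own (X s) (Suc s))) \<in> borel_measurable path_space"
proof -
  have "(\<lambda>X. ennreal (own (X s) (Suc s))) \<in> borel_measurable path_space" for s
    by (rule measurable_path_borel)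
  then show ?thesis by measurable
qed

lemma exp_cost_upto_Suc:
  assumes "is_strategy Sm" "is_strategy Sp"
  shows "exp_cost_upto own (Suc T) Sm Sp k = ennreal (own k 1) +
     (ennreal (step_prob Sm Sp k 1) * exp_cost_upto (tshift own) T (tshift Sm) (tshift Sp) (k + 1) +
      ennreal (1 - step_prob Sm Sp k 1) * exp_cost_upto (tshift own) T (tshift Sm) (tshift Sp) (k - 1))"
proof -
  interpret T: prob_space trail_space by (rule prob_space_trail)
  have split: "(\<integral>\<^sup>+\<omega>. (\<Sum>s<Suc T. ennreal (own (case_nat k (trail_path (tshift Sm) (tshift Sp) j \<omega>) s) (Suc s))) \<partial>trail_space)
     = ennreal (own k 1) + exp_cost_upto (tshift own) T (tshift Sm) (tshift Sp) j" for j
  proof -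
    let ?Y = "trail_path (tshift Sm) (tshift Sp) j"
    have "(\<Sum>s<Suc T. ennreal (own (case_nat k (?Y \<omega>) s) (Suc s)))
       = ennreal (own k 1) + (\<Sum>s<T. ennreal (tshift own (?Y \<omega> s) (Suc s)))" for \<omega>
      by (subst sum.lessThan_Suc_shift) simp
    moreover have "(\<integral>\<^sup>+\<omega>. ennreal (own k 1) + (\<Sum>s<T. ennreal (tshift own (?Y \<omega> s) (Suc s))) \<partial>trail_space)
       = (\<integral>\<^sup>+\<omega>. ennreal (own k 1) \<partial>trail_space) + exp_cost_upto (tshift own) T (tshift Sm) (tshift Sp) j"
      unfolding exp_cost_upto_def
      by (intro nn_integral_add measurable_compose[OF measurable_trail_path measurable_cost_upto] borel_measurable_const)
    ultimately show ?thesis by (simp only: nn_integral_const T.emeasure_space_1 mult_1_right)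
  qed
  let ?p = "step_prob Sm Sp k 1" and ?C = "exp_cost_upto (tshift own) T (tshift Sm) (tshift Sp)"
  have "exp_cost_upto own (Suc T) Sm Sp k =
      ennreal ?p * (ennreal (own k 1) + ?C (k + 1)) + ennreal (1 - ?p) * (ennreal (own k 1) + ?C (k - 1))"
    unfolding split[symmetric] unfolding exp_cost_upto_def
    by (rule nn_integral_first_step[where F = "\<lambda>X. \<Sum>s<Suc T. ennreal (own (X s) (Suc s))",
          OF measurable_cost_upto assms])
  also have "\<dots> = ennreal (own k 1) + (ennreal ?p * ?C (k + 1) + ennreal (1 - ?p) * ?C (k - 1))"
    by (rule weighted_const_add[OF step_prob_bounds[OF assms]])
  finally show ?thesis .
qed

text \<open>A supermartingale bound with the costs moved to the larger side, which avoids
  subtraction in \<open>ennreal\<close>. The strategies are generalised in the induction because the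
  first step replaces them by their time shifts.\<close>

lemma exp_at_le:
  assumes "is_strategy own" "is_strategy Sm" "is_strategy Sp" and v: "\<And>i. 0 \<le> v i"
    and super: "\<And>i t. step_prob Sm Sp i (Suc t) * v (i + 1) + (1 - step_prob Sm Sp i (Suc t)) * v (i - 1)
      \<le> v i + own i (Suc t)"
  shows "exp_at v T Sm Sp k \<le> ennreal (v k) + exp_cost_upto own T Sm Sp k"
  using assms(1-3) super
proof (induction T arbitrary: own Sm Sp k)
  case 0
  interpret T: prob_space trail_space by (rule prob_space_trail)
  show ?case by (simp add: exp_at_def exp_cost_upto_def T.emeasure_space_1)
next
  case (Suc T)
  let ?p = "step_prob Sm Sp k 1" and ?C = "exp_cost_upto (tshift own) T (tshift Sm) (tshift Sp)"
  have p: "0 \<le> ?p" "?p \<le> 1" using step_prob_bounds[OF Suc.prems(2,3)] by auto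
  have own: "0 \<le> own k 1" using Suc.prems(1) by (simp add: is_strategy_def)
  have IH: "exp_at v T (tshift Sm) (tshift Sp) j \<le> ennreal (v j) + ?C j" for j
    using Suc.prems by (intro Suc.IH) (simp_all only: is_strategy_tshift step_prob_tshift, simp)
  have "exp_at v (Suc T) Sm Sp k
     \<le> ennreal ?p * (ennreal (v (k + 1)) + ?C (k + 1)) + ennreal (1 - ?p) * (ennreal (v (k - 1)) + ?C (k - 1))"
    unfolding exp_at_Suc[OF Suc.prems(2,3)] by (intro add_mono mult_left_mono IH) auto
  also have "\<dots> = ennreal (?p * v (k + 1) + (1 - ?p) * v (k - 1)) + (ennreal ?p * ?C (k + 1) + ennreal (1 - ?p) * ?C (k - 1))"
    using p v by (simp add: ennreal_mult ennreal_plus distrib_left ac_simps)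
  also have "\<dots> \<le> ennreal (v k + own k 1) + (ennreal ?p * ?C (k + 1) + ennreal (1 - ?p) * ?C (k - 1))"
    using Suc.prems(4)[of k 0] by (intro add_right_mono ennreal_leI) simp
  also have "\<dots> = ennreal (v k) + exp_cost_upto own (Suc T) Sm Sp k"
    unfolding exp_cost_upto_Suc[OF Suc.prems(2,3)] using v own by (simp add: ennreal_plus ac_simps)
  finally show ?case .
qed

lemma exp_at_eq:
  assumes "is_strategy own" "is_strategy Sm" "is_strategy Sp" and v: "\<And>i. 0 \<le> v i"
    and mart: "\<And>i t. step_prob Sm Sp i (Suc t) * v (i + 1) + (1 - step_prob Sm Sp i (Suc t)) * v (i - 1)
      = v i + own i (Suc t)"
  shows "exp_at v T Sm Sp k = ennreal (v k) + exp_cost_upto own T Sm Sp k"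
  using assms(1-3) mart
proof (induction T arbitrary: own Sm Sp k)
  case 0
  interpret T: prob_space trail_space by (rule prob_space_trail)
  show ?case by (simp add: exp_at_def exp_cost_upto_def T.emeasure_space_1)
next
  case (Suc T)
  let ?p = "step_prob Sm Sp k 1" and ?C = "exp_cost_upto (tshift own) T (tshift Sm) (tshift Sp)"
  have p: "0 \<le> ?p" "?p \<le> 1" using step_prob_bounds[OF Suc.prems(2,3)] by auto
  have own: "0 \<le> own k 1" using Suc.prems(1) by (simp add: is_strategy_def)
  have IH: "exp_at v T (tshift Sm) (tshift Sp) j = ennreal (v j) + ?C j" for j
    using Suc.prems by (intro Suc.IH) (simp_all only: is_strategy_tshift step_prob_tshift, simp)
  have "exp_at v (Suc T) Sm Sp k
     = ennreal (?p * v (k + 1) + (1 - ?p) * v (k - 1)) + (ennreal ?p * ?C (k + 1) + ennreal (1 - ?p) * ?C (k - 1))"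
    unfolding exp_at_Suc[OF Suc.prems(2,3)] IH
    using p v by (simp add: ennreal_mult ennreal_plus distrib_left ac_simps)
  also have "?p * v (k + 1) + (1 - ?p) * v (k - 1) = v k + own k 1"
    using Suc.prems(4)[of k 0] by simp
  also have "ennreal (v k + own k 1) + (ennreal ?p * ?C (k + 1) + ennreal (1 - ?p) * ?C (k - 1))
      = ennreal (v k) + exp_cost_upto own (Suc T) Sm Sp k"
    unfolding exp_cost_upto_Suc[OF Suc.prems(2,3)] using v own by (simp add: ennreal_plus ac_simps)
  finally show ?case .
qed

lemma exp_cost_upto_tendsto: "(\<lambda>T. exp_cost_upto own T Sm Sp k) \<longlonglongrightarrow> exp_cost own Sm Sp k"
proof -
  have m: "(\<lambda>\<omega>. ennreal (own (trail_path Sm Sp k \<omega> s) (Suc s))) \<in> borel_measurable trail_space" for s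
    by (rule measurable_compose[OF measurable_trail_path measurable_path_borel])
  show ?thesis
    unfolding exp_cost_def exp_cost_upto_def path_cost_def nn_integral_suminf[OF m] nn_integral_sum[OF m]
    by (rule summable_LIMSEQ) simp
qed

lemma exp_cost_upto_le: "exp_cost_upto own T Sm Sp k \<le> exp_cost own Sm Sp k"
  unfolding exp_cost_def exp_cost_upto_def path_cost_def
  by (intro nn_integral_mono sum_le_suminf) auto

lemma expected_payoff_le:
  assumes strat: "is_strategy own" "is_strategy Sm" "is_strategy Sp" and v: "\<And>i. 0 \<le> v i"
    and super: "\<And>i t. step_prob Sm Sp i (Suc t) * v (i + 1) + (1 - step_prob Sm Sp i (Suc t)) * v (i - 1)
      \<le> v i + own i (Suc t)"
    and lim: "(v \<longlongrightarrow> tL) at_bot" "(v \<longlongrightarrow> tR) at_top" and tS: "tS \<le> 0"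
  shows "expected_payoff own tL tR tS Sm Sp k \<le> ereal (v k)"
proof (cases "exp_cost own Sm Sp k")
  case top
  then show ?thesis by (simp add: expected_payoff_eq)
next
  case (real c)
  interpret T: prob_space trail_space by (rule prob_space_trail)
  \<comment> \<open>Fatou needs a nonnegative receipt. Clipping at 0 changes nothing on escaping
    paths, where the receipt is a limit of values of \<open>v\<close>, and on the others it gives 0
    because \<open>tS \<le> 0\<close>.\<close>
  let ?X = "trail_path Sm Sp k" and ?t = "\<lambda>X. max 0 (terminal tL tR tS X)"
  have pointwise: "ennreal (?t X) \<le> liminf (\<lambda>T. ennreal (v (X T)))" for X
  proof (cases "filterlim X at_bot sequentially \<or> filterlim X at_top sequentially")
    case True
    have vX: "(\<lambda>T. v (X T)) \<longlonglongrightarrow> terminal tL tR tS X"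
      using True filterlim_compose[OF lim(1), of X sequentially] filterlim_compose[OF lim(2), of X sequentially]
      by (auto simp: terminal_alt)
    then have "0 \<le> terminal tL tR tS X"
      using v by (intro tendsto_lowerbound[of "\<lambda>T. v (X T)"]) auto
    then have "(\<lambda>T. ennreal (v (X T))) \<longlonglongrightarrow> ennreal (?t X)"
      using tendsto_ennrealI[OF vX] by simp
    then show ?thesis using lim_imp_Liminf by (metis order_refl trivial_limit_sequentially)
  next
    case False
    then show ?thesis using tS by (simp add: terminal_alt)
  qed
  have [measurable]: "?t \<in> borel_measurable path_space" by measurable
  have int_t: "integrable trail_space (\<lambda>\<omega>. ?t (?X \<omega>))"
  proof (rule integrable_bounded_path_fun)
    show "\<bar>?t X\<bar> \<le> \<bar>tL\<bar> + \<bar>tR\<bar> + \<bar>tS\<bar>" for X using terminal_bound[of tL tR tS X] by simp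
  qed measurable
  have "ennreal (\<integral>\<omega>. ?t (?X \<omega>) \<partial>trail_space) = (\<integral>\<^sup>+\<omega>. ennreal (?t (?X \<omega>)) \<partial>trail_space)"
    by (rule nn_integral_eq_integral[OF int_t, symmetric]) simp
  also have "\<dots> \<le> (\<integral>\<^sup>+\<omega>. liminf (\<lambda>T. ennreal (v (?X \<omega> T))) \<partial>trail_space)"
    by (intro nn_integral_mono pointwise)
  also have "\<dots> \<le> liminf (\<lambda>T. exp_at v T Sm Sp k)"
    unfolding exp_at_def
    by (intro nn_integral_liminf measurable_compose[OF measurable_trail_path measurable_path_borel])
  also have "\<dots> \<le> liminf (\<lambda>T::nat. ennreal (v k) + exp_cost own Sm Sp k)"
    using exp_at_le[OF strat v super] exp_cost_upto_le[of own _ Sm Sp k]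
    by (intro Liminf_mono always_eventually allI) (meson add_left_mono order_trans)
  also have "\<dots> = ennreal (v k + c)"
    using real v by (simp add: Liminf_const ennreal_plus)
  finally have "(\<integral>\<omega>. ?t (?X \<omega>) \<partial>trail_space) \<le> v k + c"
    using real v[of k] by (subst (asm) ennreal_le_iff) auto
  moreover have "exp_terminal tL tR tS Sm Sp k \<le> (\<integral>\<omega>. ?t (?X \<omega>) \<partial>trail_space)"
    unfolding exp_terminal_def by (intro integral_mono integrable_terminal int_t) simp
  ultimately show ?thesis unfolding expected_payoff_eq real(2) using real(1) by (simp add: enn2ereal_ennreal)
qed

section \<open>Escape of the walk and the value of the game\<close>

lemma trail_path_step: "trail_path Sm Sp k \<omega> (Suc t) \<in> {trail_path Sm Sp k \<omega> t - 1, trail_path Sm Sp k \<omega> t + 1}"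
  by simp

text \<open>After the last visit to 0 unit steps cannot change the sign, and every finite interval
  is eventually avoided.\<close>

lemma nearest_neighbour_diverges:
  fixes X :: "nat \<Rightarrow> int"
  assumes step: "\<And>t. X (Suc t) \<in> {X t - 1, X t + 1}"
    and fin: "\<And>i. \<forall>\<^sub>F t in sequentially. X t \<noteq> i"
  shows "filterlim X at_bot sequentially \<or> filterlim X at_top sequentially"
proof -
  obtain N where N: "\<And>t. N \<le> t \<Longrightarrow> X t \<noteq> 0" using fin[of 0] by (auto simp: eventually_sequentially)
  have avoid: "\<forall>\<^sub>F t in sequentially. X t \<notin> I" if "finite I" for I
  proof -
    have "\<forall>\<^sub>F t in sequentially. \<forall>i\<in>I. X t \<noteq> i"
      using fin by (intro eventually_ball_finite that) auto
    then show ?thesis by eventually_elim blast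
  qed
  show ?thesis
  proof (cases "0 < X N")
    case True
    have pos: "0 < X t" if "N \<le> t" for t using that
    proof (induction t rule: dec_induct)
      case (step t)
      then show ?case using assms(1)[of t] N[of "Suc t"] by auto
    qed (rule True)
    have "filterlim X at_top sequentially"
      unfolding filterlim_at_top
    proof
      fix z
      show "\<forall>\<^sub>F t in sequentially. z \<le> X t"
        using avoid[OF finite_atLeastAtMost_int[of 0 z]] eventually_ge_at_top[of N]
        by eventually_elim (use pos in force)
    qed
    then show ?thesis ..
  next
    case False
    have neg: "X t < 0" if "N \<le> t" for t using that
    proof (induction t rule: dec_induct)
      case base
      then show ?case using False N[of N] by auto
    next
      case (step t)
      then show ?case using assms(1)[of t] N[of "Suc t"] by auto
    qed
    have "filterlim X at_bot sequentially"
      unfolding filterlim_at_bot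
    proof
      fix z
      show "\<forall>\<^sub>F t in sequentially. X t \<le> z"
        using avoid[OF finite_atLeastAtMost_int[of z 0]] eventually_ge_at_top[of N]
        by eventually_elim (use neg in force)
    qed
    then show ?thesis ..
  qed
qed

definition diverges :: "(int \<Rightarrow> nat \<Rightarrow> real) \<Rightarrow> (int \<Rightarrow> nat \<Rightarrow> real) \<Rightarrow> int \<Rightarrow> bool" where
  "diverges Sm Sp k \<longleftrightarrow> (AE \<omega> in trail_space.
     filterlim (trail_path Sm Sp k \<omega>) at_bot sequentially \<or> filterlim (trail_path Sm Sp k \<omega>) at_top sequentially)"

text \<open>A site carrying a fixed positive stake cannot be visited infinitely often at finite total cost.\<close>

lemma finite_cost_imp_diverges:
  assumes "\<And>i. 0 < c i" "exp_cost (\<lambda>i t. c i) Sm Sp k \<noteq> top"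
  shows "diverges Sm Sp k"
proof -
  have "AE \<omega> in trail_space. path_cost (\<lambda>i t. c i) (trail_path Sm Sp k \<omega>) \<noteq> \<infinity>"
    using assms(2) unfolding exp_cost_def by (intro nn_integral_PInf_AE) (auto simp: infinity_ennreal_def)
  then show ?thesis
    unfolding diverges_def
  proof eventually_elim
    fix \<omega> assume fin: "path_cost (\<lambda>i t. c i) (trail_path Sm Sp k \<omega>) \<noteq> \<infinity>"
    let ?X = "trail_path Sm Sp k \<omega>"
    have "summable (\<lambda>t. c (?X t))"
      using fin assms(1) unfolding path_cost_def
      by (intro summable_suminf_not_top) (auto simp: less_imp_le infinity_ennreal_def)
    then have lim: "(\<lambda>t. c (?X t)) \<longlonglongrightarrow> 0" by (rule summable_LIMSEQ_zero)
    show "filterlim ?X at_bot sequentially \<or> filterlim ?X at_top sequentially"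
    proof (rule nearest_neighbour_diverges)
      show "?X (Suc t) \<in> {?X t - 1, ?X t + 1}" for t by (rule trail_path_step)
    next
      fix i
      show "\<forall>\<^sub>F t in sequentially. ?X t \<noteq> i"
        using order_tendstoD(2)[OF lim assms(1)[of i]] by eventually_elim auto
    qed
  qed
qed

text \<open>The payoff as a real number. It is meaningful only at finite cost, since
  \<open>enn2real\<close> sends \<open>top\<close> to 0.\<close>

definition game_value where
  "game_value own tL tR tS Sm Sp k = exp_terminal tL tR tS Sm Sp k - enn2real (exp_cost own Sm Sp k)"

lemma expected_payoff_eq_game_value:
  "exp_cost own Sm Sp k \<noteq> top \<Longrightarrow> expected_payoff own tL tR tS Sm Sp k = ereal (game_value own tL tR tS Sm Sp k)"
  by (cases "exp_cost own Sm Sp k") (auto simp: expected_payoff_eq game_value_def enn2ereal_ennreal)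

text \<open>Shifted by \<open>B\<close>, the martingale lies between 0 and \<open>2 * B\<close>,
  which bounds the expected cost. Finite cost forces escape, and only then does dominated
  convergence identify the limit with the terminal receipt.\<close>

lemma martingale_value:
  fixes c v :: "int \<Rightarrow> real"
  assumes strat: "is_strategy Sm" "is_strategy Sp" and c: "\<And>i. 0 < c i" and bd: "\<And>i. \<bar>v i\<bar> \<le> B"
    and mart: "\<And>i t. step_prob Sm Sp i (Suc t) * v (i + 1) + (1 - step_prob Sm Sp i (Suc t)) * v (i - 1)
      = v i + c i"
    and lim: "(v \<longlongrightarrow> vL) at_bot" "(v \<longlongrightarrow> vR) at_top"
  shows "exp_cost (\<lambda>i t. c i) Sm Sp k \<noteq> top" "diverges Sm Sp k"
    "game_value (\<lambda>i t. c i) vL vR tS Sm Sp k = v k"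
proof -
  interpret T: prob_space trail_space by (rule prob_space_trail)
  let ?X = "trail_path Sm Sp k"
  let ?cost = "\<lambda>T. exp_cost_upto (\<lambda>i t. c i) T Sm Sp k"
  define w where "w i = v i + B" for i
  have w: "0 \<le> w i" "\<bar>w i\<bar> \<le> 2 * B" for i using bd[of i] by (auto simp: w_def)
  have wmart: "step_prob Sm Sp i (Suc t) * w (i + 1) + (1 - step_prob Sm Sp i (Suc t)) * w (i - 1) = w i + c i" for i t
    using mart[of i t] by (simp add: w_def algebra_simps)
  have own: "is_strategy (\<lambda>i t. c i)" using c by (simp add: is_strategy_def less_imp_le)
  have wX: "(\<lambda>\<omega>. w (?X \<omega> T)) \<in> borel_measurable trail_space" for T
    by (rule measurable_compose[OF measurable_trail_path measurable_path_borel])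
  have int_w: "integrable trail_space (\<lambda>\<omega>. w (?X \<omega> T))" for T
    by (rule integrable_bounded_path_fun[where B = "2 * B" and F = "\<lambda>X. w (X T)", OF measurable_path_borel w(2)])
  have balance: "ennreal (\<integral>\<omega>. w (?X \<omega> T) \<partial>trail_space) = ennreal (w k) + ?cost T" for T
    unfolding exp_at_eq[OF own strat w(1) wmart, symmetric] exp_at_def
    by (rule nn_integral_eq_integral[OF int_w, symmetric]) (simp add: w)
  have "exp_cost (\<lambda>i t. c i) Sm Sp k \<le> ennreal (2 * B)"
  proof (rule LIMSEQ_le_const2[OF exp_cost_upto_tendsto], intro exI allI impI)
    fix T
    have "?cost T \<le> ennreal (\<integral>\<omega>. w (?X \<omega> T) \<partial>trail_space)" unfolding balance by simp
    also have "(\<integral>\<omega>. w (?X \<omega> T) \<partial>trail_space) \<le> (\<integral>\<omega>. 2 * B \<partial>trail_space)"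
      using w(2) by (intro integral_mono int_w) (auto simp: abs_le_iff)
    finally show "?cost T \<le> ennreal (2 * B)" by (simp add: T.prob_space ennreal_leI)
  qed
  then show fin: "exp_cost (\<lambda>i t. c i) Sm Sp k \<noteq> top"
    by (metis ennreal_less_top leD top.not_eq_extremum)
  show div: "diverges Sm Sp k" by (rule finite_cost_imp_diverges[OF c fin])
  have "(\<lambda>T. \<integral>\<omega>. w (?X \<omega> T) \<partial>trail_space) \<longlonglongrightarrow> (\<integral>\<omega>. terminal vL vR tS (?X \<omega>) + B \<partial>trail_space)"
  proof (rule integral_dominated_convergence[where w = "\<lambda>_. 2 * B"])
    show "AE \<omega> in trail_space. (\<lambda>T. w (?X \<omega> T)) \<longlonglongrightarrow> terminal vL vR tS (?X \<omega>) + B"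
      using div unfolding diverges_def
    proof eventually_elim
      fix \<omega> assume d: "filterlim (?X \<omega>) at_bot sequentially \<or> filterlim (?X \<omega>) at_top sequentially"
      have "(\<lambda>T. v (?X \<omega> T)) \<longlonglongrightarrow> terminal vL vR tS (?X \<omega>)"
        using d filterlim_compose[OF lim(1), of "?X \<omega>" sequentially] filterlim_compose[OF lim(2), of "?X \<omega>" sequentially]
        by (auto simp: terminal_alt)
      then show "(\<lambda>T. w (?X \<omega> T)) \<longlonglongrightarrow> terminal vL vR tS (?X \<omega>) + B"
        unfolding w_def by (intro tendsto_intros)
    qed
  qed (use w wX in auto)
  also have "(\<integral>\<omega>. terminal vL vR tS (?X \<omega>) + B \<partial>trail_space) = exp_terminal vL vR tS Sm Sp k + B"
    unfolding exp_terminal_def using integrable_terminal by (simp add: T.prob_space)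
  finally have w_lim: "(\<lambda>T. \<integral>\<omega>. w (?X \<omega> T) \<partial>trail_space) \<longlonglongrightarrow> exp_terminal vL vR tS Sm Sp k + B" .
  have nonneg: "0 \<le> exp_terminal vL vR tS Sm Sp k + B"
    by (rule tendsto_lowerbound[OF w_lim]) (auto intro!: always_eventually Bochner_Integration.integral_nonneg w)
  have "(\<lambda>T. ennreal (\<integral>\<omega>. w (?X \<omega> T) \<partial>trail_space)) \<longlonglongrightarrow> ennreal (exp_terminal vL vR tS Sm Sp k + B)"
    by (intro tendsto_ennrealI w_lim)
  moreover have "(\<lambda>T. ennreal (w k) + ?cost T) \<longlonglongrightarrow> ennreal (w k) + exp_cost (\<lambda>i t. c i) Sm Sp k"
    by (intro tendsto_add tendsto_const exp_cost_upto_tendsto)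
  ultimately have "ennreal (exp_terminal vL vR tS Sm Sp k + B) = ennreal (w k) + exp_cost (\<lambda>i t. c i) Sm Sp k"
    unfolding balance by (rule LIMSEQ_unique)
  moreover obtain r where r: "0 \<le> r" "exp_cost (\<lambda>i t. c i) Sm Sp k = ennreal r"
    using fin by (cases "exp_cost (\<lambda>i t. c i) Sm Sp k") auto
  ultimately have "exp_terminal vL vR tS Sm Sp k + B = w k + r"
    using nonneg w(1)[of k] by (simp flip: ennreal_plus)
  then show "game_value (\<lambda>i t. c i) vL vR tS Sm Sp k = v k"
    using r by (simp add: game_value_def w_def)
qed

text \<open>Finiteness is required of the continuation only, so the lemma also applies to a strategy
  altered at time 1 and equal to an equilibrium strategy afterwards.\<close>

lemma game_value_first_step:
  assumes strat: "is_strategy own" "is_strategy Sm" "is_strategy Sp"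
    and fin: "\<And>j. exp_cost (tshift own) (tshift Sm) (tshift Sp) j \<noteq> top"
  shows "exp_cost own Sm Sp k \<noteq> top"
    "game_value own tL tR tS Sm Sp k =
      step_prob Sm Sp k 1 * game_value (tshift own) tL tR tS (tshift Sm) (tshift Sp) (k + 1) +
      (1 - step_prob Sm Sp k 1) * game_value (tshift own) tL tR tS (tshift Sm) (tshift Sp) (k - 1) - own k 1"
proof -
  let ?p = "step_prob Sm Sp k 1"
  have p: "0 \<le> ?p" "?p \<le> 1" using step_prob_bounds[OF strat(2,3)] by auto
  have own: "0 \<le> own k 1" using strat(1) by (simp add: is_strategy_def)
  define C where "C j = enn2real (exp_cost (tshift own) (tshift Sm) (tshift Sp) j)" for j
  have C: "0 \<le> C j" "exp_cost (tshift own) (tshift Sm) (tshift Sp) j = ennreal (C j)" for j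
    using fin[of j] by (simp_all add: C_def less_top)
  have cost: "exp_cost own Sm Sp k = ennreal (own k 1 + (?p * C (k + 1) + (1 - ?p) * C (k - 1)))"
    using p own C(1) by (subst exp_cost_first_step[OF strat(2,3)]) (simp add: C(2) ennreal_mult)
  then show "exp_cost own Sm Sp k \<noteq> top" by simp
  have "enn2real (exp_cost own Sm Sp k) = own k 1 + (?p * C (k + 1) + (1 - ?p) * C (k - 1))"
    unfolding cost using p own C(1) by (subst enn2real_ennreal) auto
  then show "game_value own tL tR tS Sm Sp k =
      ?p * game_value (tshift own) tL tR tS (tshift Sm) (tshift Sp) (k + 1) +
      (1 - ?p) * game_value (tshift own) tL tR tS (tshift Sm) (tshift Sp) (k - 1) - own k 1"
    unfolding game_value_def exp_terminal_first_step[OF strat(2,3), of tL tR tS k] C(2)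
    using C(1) by (simp add: algebra_simps)
qed

text \<open>On escaping paths the receipt is affine in the indicator of escape to the right. This
  compares one gameplay under different receipts.\<close>

lemma diverges_exp_terminal:
  assumes "diverges Sm Sp k"
  shows "exp_terminal tL tR tS Sm Sp k = tL + (tR - tL) * exp_terminal 0 1 0 Sm Sp k"
proof -
  interpret T: prob_space trail_space by (rule prob_space_trail)
  have "exp_terminal tL tR tS Sm Sp k
     = (\<integral>\<omega>. tL + (tR - tL) * terminal 0 1 0 (trail_path Sm Sp k \<omega>) \<partial>trail_space)"
    unfolding exp_terminal_def
  proof (rule integral_cong_AE)
    show "AE \<omega> in trail_space. terminal tL tR tS (trail_path Sm Sp k \<omega>)
        = tL + (tR - tL) * terminal 0 1 0 (trail_path Sm Sp k \<omega>)"
      using assms unfolding diverges_def by eventually_elim (auto simp: terminal_alt)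
  qed measurable
  also have "\<dots> = tL + (tR - tL) * exp_terminal 0 1 0 Sm Sp k"
    unfolding exp_terminal_def using integrable_terminal by (simp add: T.prob_space)
  finally show ?thesis .
qed

section \<open>Deterministic gameplay\<close>

text \<open>The value 1 is excluded because a step to the right requires the uniform to lie strictly
  below the step probability, even when that is 1.\<close>

lemma AE_trail_coordinates: "AE \<omega> in trail_space. \<forall>t. 0 \<le> \<omega> t \<and> \<omega> t < 1"
proof -
  have "AE u in unit_uniform. 0 \<le> u \<and> u < 1"
  proof (rule AE_uniform_measureI)
    show "AE u in lborel. u \<in> {0..1} \<longrightarrow> 0 \<le> u \<and> u < (1::real)"
      using AE_lborel_singleton[of "1::real"] by eventually_elim auto
  qed simp
  then have "AE \<omega> in trail_space. 0 \<le> \<omega> t \<and> \<omega> t < 1" for t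
    unfolding trail_space_def by (intro AE_PiM_component prob_space_unit_uniform) auto
  then show ?thesis by (simp add: AE_all_countable)
qed

lemma exp_terminal_always_right:
  assumes "\<And>i t. step_prob Sm Sp i (Suc t) = 1"
  shows "exp_terminal tL tR tS Sm Sp k = tR"
proof -
  interpret T: prob_space trail_space by (rule prob_space_trail)
  have "AE \<omega> in trail_space. terminal tL tR tS (trail_path Sm Sp k \<omega>) = tR"
    using AE_trail_coordinates
  proof eventually_elim
    fix \<omega> :: "nat \<Rightarrow> real" assume \<omega>: "\<forall>t. 0 \<le> \<omega> t \<and> \<omega> t < 1"
    have path: "trail_path Sm Sp k \<omega> t = k + int t" for t
      by (induction t) (use \<omega> assms in auto)
    have top: "filterlim (trail_path Sm Sp k \<omega>) at_top sequentially"
      unfolding filterlim_at_top eventually_sequentially path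
    proof
      fix z show "\<exists>N. \<forall>t\<ge>N. z \<le> k + int t" by (rule exI[of _ "nat (z - k)"]) auto
    qed
    \<comment> \<open>\<open>terminal\<close> tests escape to the left first, so that branch has to
      be ruled out.\<close>
    moreover have "\<not> filterlim (trail_path Sm Sp k \<omega>) at_bot sequentially"
      unfolding filterlim_at_bot eventually_sequentially path by (auto intro!: exI[of _ "k - 1"])
    ultimately show "terminal tL tR tS (trail_path Sm Sp k \<omega>) = tR" by (simp add: terminal_alt)
  qed
  then have "exp_terminal tL tR tS Sm Sp k = (\<integral>\<omega>. tR \<partial>trail_space)"
    unfolding exp_terminal_def by (intro integral_cong_AE) auto
  then show ?thesis by (simp add: T.prob_space)
qed

lemma exp_terminal_always_left:
  assumes "\<And>i t. step_prob Sm Sp i (Suc t) = 0"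
  shows "exp_terminal tL tR tS Sm Sp k = tL"
proof -
  interpret T: prob_space trail_space by (rule prob_space_trail)
  have "AE \<omega> in trail_space. terminal tL tR tS (trail_path Sm Sp k \<omega>) = tL"
    using AE_trail_coordinates
  proof eventually_elim
    fix \<omega> :: "nat \<Rightarrow> real" assume \<omega>: "\<forall>t. 0 \<le> \<omega> t \<and> \<omega> t < 1"
    have path: "trail_path Sm Sp k \<omega> t = k - int t" for t
      by (induction t) (use \<omega> assms in \<open>auto simp: not_less\<close>)
    have "filterlim (trail_path Sm Sp k \<omega>) at_bot sequentially"
      unfolding filterlim_at_bot eventually_sequentially path
    proof
      fix z show "\<exists>N. \<forall>t\<ge>N. k - int t \<le> z" by (rule exI[of _ "nat (k - z)"]) auto
    qed
    then show "terminal tL tR tS (trail_path Sm Sp k \<omega>) = tL" by (simp add: terminal_alt)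
  qed
  then have "exp_terminal tL tR tS Sm Sp k = (\<integral>\<omega>. tL \<partial>trail_space)"
    unfolding exp_terminal_def by (intro integral_cong_AE) auto
  then show ?thesis by (simp add: T.prob_space)
qed

text \<open>Stakes are charged from time 1 on, so along every path they add up to e/2 + e/4 + ... =
  e. This is a positive bid at every turn for an arbitrarily small total price.\<close>

lemma exp_cost_geometric:
  assumes "0 \<le> e"
  shows "exp_cost (\<lambda>i t. e * (1/2) ^ t) Sm Sp k = ennreal e"
proof -
  interpret T: prob_space trail_space by (rule prob_space_trail)
  have "(\<lambda>t. e * (1/2) ^ Suc t) sums (e * 1)" by (intro sums_mult power_half_series)
  then have "path_cost (\<lambda>i t. e * (1/2) ^ t) X = ennreal e" for X
    unfolding path_cost_def using assms by (subst suminf_ennreal_eq) auto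
  then show ?thesis by (simp add: exp_cost_def T.emeasure_space_1)
qed

section \<open>Stakes at a single site\<close>

text \<open>The second argument is the player's own stake, the first her opponent's.\<close>

definition win_prob :: "real \<Rightarrow> real \<Rightarrow> real" where
  "win_prob d c = (if d + c = 0 then 1/2 else c / (d + c))"

lemma step_prob_win_prob: "step_prob Sm Sp i t = win_prob (Sm i t) (Sp i t)"
  by (simp add: step_prob_def win_prob_def)

lemma win_prob_swap: "1 - win_prob d c = win_prob c d"
proof (cases "d + c = 0")
  case False
  then have "1 - c / (d + c) = d / (d + c)" by (simp add: diff_divide_eq_iff)
  then show ?thesis using False by (simp add: win_prob_def add.commute)
qed (simp add: win_prob_def add.commute)

lemma convex_combination: "p * U + (1 - p) * W = W + p * (U - W)" for p U W :: real
  by (simp add: algebra_simps)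

text \<open>Here \<open>U\<close> and \<open>W\<close> are the values after winning and losing the
  turn. Against stake 0 any positive bid wins, so a positive optimum could be undercut; an interior
  optimum satisfies the first-order condition. The case \<open>c = 0 \<and> 0 < d\<close> survives
  here and is excluded from the opponent's side.\<close>

lemma optimal_stake_cases:
  assumes nonneg: "0 \<le> c" "0 \<le> d"
    and opt: "\<And>r. 0 \<le> r \<Longrightarrow> win_prob d r * U + (1 - win_prob d r) * W - r
      \<le> win_prob d c * U + (1 - win_prob d c) * W - c"
  shows "c = 0 \<and> d = 0 \<and> U \<le> W \<or> c = 0 \<and> 0 < d \<or> 0 < c \<and> 0 < d \<and> (c + d)\<^sup>2 = d * (U - W)"
proof (cases "d = 0")
  case True
  have win: "win_prob d r = 1" if "0 < r" for r using that True by (simp add: win_prob_def)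
  have "c = 0"
  proof (rule ccontr)
    assume "c \<noteq> 0"
    then show False using opt[of "c / 2"] win[of "c / 2"] win[of c] nonneg by simp
  qed
  \<comment> \<open>Sure victory can be bought at any price \<open>e > 0\<close>, while abstaining
    yields a fair coin.\<close>
  moreover have "U \<le> (U + W) / 2"
  proof (rule field_le_epsilon)
    fix e :: real assume "0 < e"
    then show "U \<le> (U + W) / 2 + e"
      using opt[of e] win[of e] \<open>c = 0\<close> True by (simp add: win_prob_def field_simps)
  qed
  ultimately show ?thesis using True by auto
next
  case False
  then have d: "0 < d" using nonneg by simp
  show ?thesis
  proof (cases "c = 0")
    case False
    then have c: "0 < c" using nonneg by simp
    let ?F = "\<lambda>r. r / (d + r) * (U - W) - r"
    have "(?F has_real_derivative d / (d + c)\<^sup>2 * (U - W) - 1) (at c)"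
      using c d by (auto intro!: derivative_eq_intros simp: field_simps power2_eq_square)
    moreover have "\<forall>y. \<bar>c - y\<bar> < c \<longrightarrow> ?F y \<le> ?F c"
    proof (intro allI impI)
      fix y assume "\<bar>c - y\<bar> < c"
      then have y: "0 < y" by auto
      show "?F y \<le> ?F c"
        using opt[of y] y c d unfolding convex_combination by (simp add: win_prob_def)
    qed
    ultimately have "d / (d + c)\<^sup>2 * (U - W) - 1 = 0" using c by (intro DERIV_local_max)
    then have "(c + d)\<^sup>2 = d * (U - W)" using c d by (simp add: field_simps)
    then show ?thesis using c d by simp
  qed (use d in auto)
qed

text \<open>Eliminating \<open>V\<close> and \<open>U - W\<close> leaves a gap of exactly
  \<open>(c - r)\<^sup>2 / (d + r)\<close> between the two sides, so \<open>c\<close> is a global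
  optimum.\<close>

lemma stake_le_optimal:
  fixes c d r :: real
  assumes "0 < c" "0 < d" "0 \<le> r" and opt: "(c + d)\<^sup>2 = d * (U - W)"
    and val: "(c + d) * (V + c) = c * U + d * W"
  shows "win_prob d r * U + (1 - win_prob d r) * W \<le> V + r"
proof -
  define M where "M = U - W"
  have M: "M = (c + d)\<^sup>2 / d" using opt assms by (simp add: M_def field_simps)
  have "(c + d) * (V + c) = (c + d) * W + c * M" using val by (simp add: M_def algebra_simps)
  also have "\<dots> = (c + d) * (W + c * (c + d) / d)"
    unfolding M using assms by (simp add: field_simps power2_eq_square)
  finally have "V + c = W + c * (c + d) / d" unfolding mult_cancel_left using assms by auto
  then have V: "V = W + c * (c + d) / d - c" by simp
  have w: "win_prob d r = r / (d + r)" using assms by (simp add: win_prob_def)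
  have "win_prob d r * U + (1 - win_prob d r) * W = W + r / (d + r) * M"
    unfolding w M_def by (rule convex_combination)
  moreover have "r / (d + r) * M \<le> c * (c + d) / d - c + r"
  proof -
    have "r * (c + d)\<^sup>2 \<le> (c * (c + d) - c * d + r * d) * (d + r)"
    proof -
      have "(c * (c + d) - c * d + r * d) * (d + r) - r * (c + d)\<^sup>2 = d * (c - r)\<^sup>2"
        by (simp add: power2_eq_square algebra_simps)
      moreover have "0 \<le> d * (c - r)\<^sup>2" using assms by simp
      ultimately show ?thesis by linarith
    qed
    then have "r * (c + d)\<^sup>2 / (d + r) \<le> c * (c + d) - c * d + r * d"
      using assms by (simp add: pos_divide_le_eq)
    then have "r * (c + d)\<^sup>2 / (d + r) / d \<le> (c * (c + d) - c * d + r * d) / d"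
      using assms by (intro divide_right_mono) auto
    moreover have "(c * (c + d) - c * d + r * d) / d = c * (c + d) / d - c + r"
      using assms by (simp add: add_divide_distrib diff_divide_distrib)
    moreover have "r / (d + r) * M = r * (c + d)\<^sup>2 / (d + r) / d" by (simp add: M)
    ultimately show ?thesis by simp
  qed
  ultimately show ?thesis using V by simp
qed

lemma stake_eq_optimal:
  fixes c d :: real
  assumes "0 < c" "0 < d" and val: "(c + d) * (V + c) = c * U + d * W"
  shows "win_prob d c * U + (1 - win_prob d c) * W = V + c"
proof -
  have "V + c = (c * U + d * W) / (c + d)" using assms by (simp add: field_simps)
  moreover have "1 - c / (d + c) = d / (d + c)" using assms by (simp add: field_simps)
  ultimately show ?thesis using assms by (simp add: win_prob_def add_divide_distrib ac_simps)
qed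

section \<open>Positive ABMN solutions are equilibria\<close>

context ABMN_pos
begin

lemma stakes_strategy: "is_strategy (\<lambda>i t. a i)" "is_strategy (\<lambda>i t. b i)"
  using stakes_pos by (auto simp: is_strategy_def less_imp_le)

text \<open>For \<open>n\<close> the players are exchanged, a win of Mina being a step to the left,
  so that the single-site lemmas fit both.\<close>

lemma equations:
  "(a i + b i) * (m i + a i) = a i * m (i + 1) + b i * m (i - 1)"
  "(b i + a i) * (n i + b i) = b i * n (i - 1) + a i * n (i + 1)"
  "(a i + b i)\<^sup>2 = b i * (m (i + 1) - m (i - 1))" "(b i + a i)\<^sup>2 = a i * (n (i - 1) - n (i + 1))"
  using pos[unfolded ABMN_positive_def ABMN_def, THEN conjunct1, rule_format, of i]
  by (simp_all add: add.commute[of "b i" "a i"] add.commute[of "b i * n (i - 1)"])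

lemma maxine_martingale:
  "step_prob (\<lambda>i t. b i) (\<lambda>i t. a i) i (Suc t) * m (i + 1) +
    (1 - step_prob (\<lambda>i t. b i) (\<lambda>i t. a i) i (Suc t)) * m (i - 1) = m i + a i"
  unfolding step_prob_win_prob by (rule stake_eq_optimal[OF stakes_pos equations(1)])

lemma mina_martingale:
  "step_prob (\<lambda>i t. b i) (\<lambda>i t. a i) i (Suc t) * n (i + 1) +
    (1 - step_prob (\<lambda>i t. b i) (\<lambda>i t. a i) i (Suc t)) * n (i - 1) = n i + b i"
  using stake_eq_optimal[OF stakes_pos(2,1) equations(2)[of i]]
  unfolding step_prob_win_prob win_prob_swap by linarith

lemma maxine_value:
  assumes "(m \<longlongrightarrow> mL) at_bot" "(m \<longlongrightarrow> mR) at_top"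
  shows "exp_cost (\<lambda>i t. a i) (\<lambda>i t. b i) (\<lambda>i t. a i) k \<noteq> top"
    "diverges (\<lambda>i t. b i) (\<lambda>i t. a i) k"
    "game_value (\<lambda>i t. a i) mL mR tS (\<lambda>i t. b i) (\<lambda>i t. a i) k = m k"
proof -
  have "\<bar>m i\<bar> \<le> \<bar>mL\<bar> + \<bar>mR\<bar>" for i
    using limit_bounds(1)[OF assms(1), of i] limit_bounds(2)[OF assms(2), of i] by linarith
  note mv = martingale_value[OF stakes_strategy(2,1) stakes_pos(1) this maxine_martingale assms]
  show "exp_cost (\<lambda>i t. a i) (\<lambda>i t. b i) (\<lambda>i t. a i) k \<noteq> top"
    "diverges (\<lambda>i t. b i) (\<lambda>i t. a i) k"
    "game_value (\<lambda>i t. a i) mL mR tS (\<lambda>i t. b i) (\<lambda>i t. a i) k = m k"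
    by (rule mv)+
qed

lemma mina_value:
  assumes "(n \<longlongrightarrow> nL) at_bot" "(n \<longlongrightarrow> nR) at_top"
  shows "exp_cost (\<lambda>i t. b i) (\<lambda>i t. b i) (\<lambda>i t. a i) k \<noteq> top"
    "game_value (\<lambda>i t. b i) nL nR tS (\<lambda>i t. b i) (\<lambda>i t. a i) k = n k"
proof -
  have "\<bar>n i\<bar> \<le> \<bar>nL\<bar> + \<bar>nR\<bar>" for i
    using limit_bounds(3)[OF assms(1), of i] limit_bounds(4)[OF assms(2), of i] by linarith
  note mv = martingale_value[OF stakes_strategy(2,1) stakes_pos(2) this mina_martingale assms]
  show "exp_cost (\<lambda>i t. b i) (\<lambda>i t. b i) (\<lambda>i t. a i) k \<noteq> top"
    "game_value (\<lambda>i t. b i) nL nR tS (\<lambda>i t. b i) (\<lambda>i t. a i) k = n k"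
    by (rule mv)+
qed

lemma nash:
  assumes lim: "(m \<longlongrightarrow> 0) at_bot" "(m \<longlongrightarrow> mR) at_top" "(n \<longlongrightarrow> nL) at_bot" "(n \<longlongrightarrow> 0) at_top"
    and "mS \<le> 0" "nS \<le> 0"
  shows "trail_nash 0 mR nL 0 mS nS (\<lambda>i t. b i) (\<lambda>i t. a i)"
proof -
  let ?A = "\<lambda>i (t::nat). a i" and ?B = "\<lambda>i (t::nat). b i"
  have "expected_payoff S nL 0 nS S ?A k \<le> expected_payoff ?B nL 0 nS ?B ?A k" if S: "is_strategy S" for S k
  proof -
    have "expected_payoff S nL 0 nS S ?A k \<le> ereal (n k)"
    proof (rule expected_payoff_le[OF S S stakes_strategy(1) _ _ lim(3,4) \<open>nS \<le> 0\<close>])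
      show "0 \<le> n i" for i using limit_bounds(4)[OF lim(4), of i] by simp
      show "step_prob S ?A i (Suc t) * n (i + 1) + (1 - step_prob S ?A i (Suc t)) * n (i - 1)
          \<le> n i + S i (Suc t)" for i t
      proof -
        have "0 \<le> S i (Suc t)" using S by (simp add: is_strategy_def)
        from stake_le_optimal[OF stakes_pos(2,1) this equations(4,2)[of i]] show ?thesis
          unfolding step_prob_win_prob win_prob_swap by linarith
      qed
    qed
    also have "ereal (n k) = expected_payoff ?B nL 0 nS ?B ?A k"
      using mina_value[OF lim(3,4)] by (simp add: expected_payoff_eq_game_value)
    finally show ?thesis .
  qed
  moreover have "expected_payoff S 0 mR mS ?B S k \<le> expected_payoff ?A 0 mR mS ?B ?A k"
    if S: "is_strategy S" for S k
  proof -
    have "expected_payoff S 0 mR mS ?B S k \<le> ereal (m k)"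
    proof (rule expected_payoff_le[OF S stakes_strategy(2) S _ _ lim(1,2) \<open>mS \<le> 0\<close>])
      show "0 \<le> m i" for i using limit_bounds(1)[OF lim(1), of i] by simp
      show "step_prob ?B S i (Suc t) * m (i + 1) + (1 - step_prob ?B S i (Suc t)) * m (i - 1)
          \<le> m i + S i (Suc t)" for i t
      proof -
        have "0 \<le> S i (Suc t)" using S by (simp add: is_strategy_def)
        from stake_le_optimal[OF stakes_pos this equations(3,1)[of i]] show ?thesis
          unfolding step_prob_win_prob .
      qed
    qed
    also have "ereal (m k) = expected_payoff ?A 0 mR mS ?B ?A k"
      using maxine_value[OF lim(1,2)] by (simp add: expected_payoff_eq_game_value)
    finally show ?thesis .
  qed
  ultimately show ?thesis
    using stakes_strategy by (simp add: trail_nash_def mina_payoff_def maxine_payoff_def)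
qed

end


section \<open>Equilibria are standard solutions\<close>

lemma expected_payoff_finite_imp:
  assumes "ereal r \<le> expected_payoff own tL tR tS Sm Sp k"
  shows "exp_cost own Sm Sp k \<noteq> top"
  using assms by (auto simp: expected_payoff_eq)

lemma expected_payoff_zero_stake:
  "expected_payoff (\<lambda>i t. 0) tL tR tS Sm Sp k = ereal (exp_terminal tL tR tS Sm Sp k)"
  by (simp add: expected_payoff_eq exp_cost_def path_cost_def zero_ennreal.rep_eq)

locale TI_equilibrium =
  fixes a b :: "int \<Rightarrow> real" and x mS nS :: real
  assumes nash: "trail_nash 0 1 x 0 mS nS (\<lambda>i t. b i) (\<lambda>i t. a i)"
    and x_pos: "0 < x" and mS: "mS \<le> 0" and nS: "nS \<le> 0"
begin

abbreviation "A \<equiv> \<lambda>i (t::nat). a i"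
abbreviation "B \<equiv> \<lambda>i (t::nat). b i"

text \<open>\<open>m\<close> and \<open>n\<close> are the equilibrium payoffs; the ABMN equations
  and the limits are derived for them below.\<close>

definition m :: "int \<Rightarrow> real" where "m = game_value A 0 1 mS B A"
definition n :: "int \<Rightarrow> real" where "n = game_value B x 0 nS B A"

lemma strategies: "is_strategy A" "is_strategy B"
  using nash by (auto simp: trail_nash_def)

lemma stakes_nonneg: "0 \<le> a i" "0 \<le> b i"
  using strategies by (auto simp: is_strategy_def)

lemma maxine_deviation: "is_strategy S \<Longrightarrow> expected_payoff S 0 1 mS B S k \<le> expected_payoff A 0 1 mS B A k"
  using nash by (auto simp: trail_nash_def maxine_payoff_def)

lemma mina_deviation: "is_strategy S \<Longrightarrow> expected_payoff S x 0 nS S A k \<le> expected_payoff B x 0 nS B A k"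
  using nash by (auto simp: trail_nash_def mina_payoff_def)

text \<open>Infinite cost means payoff minus infinity, which the strategy of never staking would
  improve.\<close>

lemma cost_finite: "exp_cost A B A k \<noteq> top" "exp_cost B B A k \<noteq> top"
proof -
  have zero: "is_strategy (\<lambda>i t. 0)" by (simp add: is_strategy_def)
  show "exp_cost A B A k \<noteq> top" "exp_cost B B A k \<noteq> top"
    using maxine_deviation[OF zero, of k] mina_deviation[OF zero, of k]
    unfolding expected_payoff_zero_stake by (auto dest: expected_payoff_finite_imp)
qed

lemma payoffs:
  "expected_payoff A 0 1 mS B A k = ereal (m k)" "expected_payoff B x 0 nS B A k = ereal (n k)"
  using cost_finite by (simp_all add: expected_payoff_eq_game_value m_def n_def)

lemma m_first_step: "m k = win_prob (b k) (a k) * m (k + 1) + (1 - win_prob (b k) (a k)) * m (k - 1) - a k"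
  using game_value_first_step(2)[OF strategies(1) strategies(2) strategies(1), where k = k and tL = 0 and tR = 1 and tS = mS] cost_finite
  by (simp add: m_def step_prob_win_prob)

lemma n_first_step: "n k = win_prob (b k) (a k) * n (k + 1) + (1 - win_prob (b k) (a k)) * n (k - 1) - b k"
  using game_value_first_step(2)[OF strategies(2) strategies(2) strategies(1), where k = k and tL = x and tR = 0 and tS = nS] cost_finite
  by (simp add: n_def step_prob_win_prob)

text \<open>The deviation replaces the stake at time 1 only. Afterwards play continues in
  equilibrium, with value \<open>m\<close> at the site reached.\<close>

lemma maxine_one_step:
  assumes "0 \<le> r"
  shows "win_prob (b k) r * m (k + 1) + (1 - win_prob (b k) r) * m (k - 1) - r \<le> m k"
proof -
  define S where "S i t = (if t = 1 then r else a i)" for i :: int and t :: nat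
  have S: "is_strategy S" using assms stakes_nonneg by (simp add: is_strategy_def S_def)
  have shift: "tshift S = A" by (auto simp: tshift_def S_def fun_eq_iff)
  note first = game_value_first_step[OF S strategies(2) S, unfolded shift tshift_const, OF cost_finite(1)]
  have "ereal (game_value S 0 1 mS B S k) \<le> ereal (m k)"
    using maxine_deviation[OF S, of k] first(1) by (simp add: expected_payoff_eq_game_value payoffs)
  then show ?thesis
    using first(2)[where k = k and tL = 0 and tR = 1 and tS = mS] by (simp add: m_def step_prob_win_prob S_def)
qed

lemma mina_one_step:
  assumes "0 \<le> r"
  shows "win_prob (a k) r * n (k - 1) + (1 - win_prob (a k) r) * n (k + 1) - r \<le> n k"
proof -
  define S where "S i t = (if t = 1 then r else b i)" for i :: int and t :: nat
  have S: "is_strategy S" using assms stakes_nonneg by (simp add: is_strategy_def S_def)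
  have shift: "tshift S = B" by (auto simp: tshift_def S_def fun_eq_iff)
  note first = game_value_first_step[OF S S strategies(1), unfolded shift tshift_const, OF cost_finite(2)]
  have "ereal (game_value S x 0 nS S A k) \<le> ereal (n k)"
    using mina_deviation[OF S, of k] first(1) by (simp add: expected_payoff_eq_game_value payoffs)
  moreover have "game_value S x 0 nS S A k = win_prob r (a k) * n (k + 1) + win_prob (a k) r * n (k - 1) - r"
    using first(2)[where k = k and tL = x and tR = 0 and tS = nS] by (simp add: n_def step_prob_win_prob S_def win_prob_swap)
  ultimately show ?thesis
    unfolding win_prob_swap by simp
qed

text \<open>Neither player can stake alone: each analysis allows a positive own stake only against a
  positive one.\<close>

lemma site_cases:
  obtains (zero) "a k = 0" "b k = 0" "m (k + 1) \<le> m k" "m k \<le> m (k - 1)"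
  | (positive) "0 < a k" "0 < b k" "(a k + b k)\<^sup>2 = b k * (m (k + 1) - m (k - 1))"
      "(a k + b k)\<^sup>2 = a k * (n (k - 1) - n (k + 1))"
proof -
  have "a k = 0 \<and> b k = 0 \<and> m (k + 1) \<le> m (k - 1) \<or> a k = 0 \<and> 0 < b k \<or>
      0 < a k \<and> 0 < b k \<and> (a k + b k)\<^sup>2 = b k * (m (k + 1) - m (k - 1))"
    using maxine_one_step[of _ k] m_first_step[of k] stakes_nonneg
    by (intro optimal_stake_cases) auto
  moreover have "b k = 0 \<and> a k = 0 \<and> n (k - 1) \<le> n (k + 1) \<or> b k = 0 \<and> 0 < a k \<or>
      0 < b k \<and> 0 < a k \<and> (b k + a k)\<^sup>2 = a k * (n (k - 1) - n (k + 1))"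
  proof (rule optimal_stake_cases)
    fix r :: real assume "0 \<le> r"
    from mina_one_step[OF this, of k] n_first_step[of k]
    show "win_prob (a k) r * n (k - 1) + (1 - win_prob (a k) r) * n (k + 1) - r
       \<le> win_prob (a k) (b k) * n (k - 1) + (1 - win_prob (a k) (b k)) * n (k + 1) - b k"
      unfolding win_prob_swap by linarith
  qed (use stakes_nonneg in auto)
  ultimately consider "a k = 0" "b k = 0" "m (k + 1) \<le> m (k - 1)"
    | "0 < a k" "0 < b k" "(a k + b k)\<^sup>2 = b k * (m (k + 1) - m (k - 1))"
      "(a k + b k)\<^sup>2 = a k * (n (k - 1) - n (k + 1))"
    by (auto simp: add.commute)
  then show ?thesis
  proof cases
    case 1
    \<comment> \<open>The convention 0/0 = 1/2 makes the step fair, so \<open>m k\<close> is the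
      mean of its neighbours.\<close>
    then have "m k = (m (k + 1) + m (k - 1)) / 2" using m_first_step[of k] by (simp add: win_prob_def)
    then show ?thesis using 1 zero by simp
  next
    case 2
    then show ?thesis by (rule positive)
  qed
qed

lemma site_equations:
  assumes "0 < a k" "0 < b k"
  shows "(a k + b k) * (m k + a k) = a k * m (k + 1) + b k * m (k - 1)"
    "(a k + b k) * (n k + b k) = a k * n (k + 1) + b k * n (k - 1)"
proof -
  have w: "win_prob (b k) (a k) = a k / (a k + b k)" "1 - win_prob (b k) (a k) = b k / (a k + b k)"
    using assms win_prob_swap[of "b k" "a k"] by (auto simp: win_prob_def add.commute)
  have "m k + a k = (a k * m (k + 1) + b k * m (k - 1)) / (a k + b k)"
    "n k + b k = (a k * n (k + 1) + b k * n (k - 1)) / (a k + b k)"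
    using m_first_step[of k] n_first_step[of k] unfolding w(2) unfolding w(1)
    by (simp_all add: add_divide_distrib)
  then show "(a k + b k) * (m k + a k) = a k * m (k + 1) + b k * m (k - 1)"
    "(a k + b k) * (n k + b k) = a k * n (k + 1) + b k * n (k - 1)"
    using assms by simp_all
qed

lemma positive_site_m_increasing:
  assumes "0 < a k"
  shows "m (k - 1) < m k" "m k < m (k + 1)"
proof -
  have "m k - m (k - 1) = (a k)\<^sup>2 / b k \<and> m (k + 1) - m k = 2 * a k + b k \<and> 0 < b k"
  proof (cases rule: site_cases[of k])
    case positive
    then show ?thesis
      using ABMN_site_iff[of "a k" "b k" "m k" "m (k + 1)" "m (k - 1)" "n k" "n (k + 1)" "n (k - 1)"]
        site_equations[of k] by blast
  qed (use assms in simp)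
  then have "0 < m k - m (k - 1)" "0 < m (k + 1) - m k" using assms by auto
  then show "m (k - 1) < m k" "m k < m (k + 1)" by simp_all
qed

text \<open>Sites \<open>k\<close> and \<open>k + 1\<close> share the increment
  \<open>m (k + 1) - m k\<close>, which is positive next to a positive site and at most 0 next to a
  zero site.\<close>

lemma positive_step: "0 < a k \<longleftrightarrow> 0 < a (k + 1)"
proof -
  have z: "m (i + 1) \<le> m i" "m i \<le> m (i - 1)" if "\<not> 0 < a i" for i
    using that by (cases rule: site_cases[of i]; simp)+
  show ?thesis
    using positive_site_m_increasing(2)[of k] positive_site_m_increasing(1)[of "k + 1"]
      z(1)[of k] z(2)[of "k + 1"]
    by (cases "0 < a k"; cases "0 < a (k + 1)") simp_all
qed

text \<open>Without stakes each player could secure nearly the full prize, so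
  \<open>1 \<le> m 0\<close> and \<open>x \<le> n 0\<close>. Only one of them can win, which bounds
  a weighted sum of the payoffs by \<open>x\<close>.\<close>

lemma some_stake: "\<exists>k. 0 < a k"
proof (rule ccontr)
  assume "\<not> ?thesis"
  then have "a k = 0" "b k = 0" for k
    by (cases rule: site_cases[of k]; simp)+
  then have ab: "a = (\<lambda>_. 0)" "b = (\<lambda>_. 0)" by auto
  have geom: "is_strategy (\<lambda>i t. e * (1/2) ^ t)" if "0 < e" for e
    using that by (simp add: is_strategy_def)
  have "1 \<le> m 0"
  proof (rule field_le_epsilon)
    fix e :: real assume e: "0 < e"
    let ?S = "\<lambda>(i::int) t. e * (1/2) ^ t"
    have "exp_terminal 0 1 mS B ?S 0 = 1"
      using e by (intro exp_terminal_always_right) (simp add: step_prob_def ab)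
    then have "expected_payoff ?S 0 1 mS B ?S 0 = ereal (1 - e)"
      using e exp_cost_geometric[of e B ?S 0] by (simp add: expected_payoff_eq enn2ereal_ennreal)
    then show "1 \<le> m 0 + e" using maxine_deviation[OF geom[OF e], of 0] by (simp add: payoffs)
  qed
  moreover have "x \<le> n 0"
  proof (rule field_le_epsilon)
    fix e :: real assume e: "0 < e"
    let ?S = "\<lambda>(i::int) t. e * (1/2) ^ t"
    have "exp_terminal x 0 nS ?S A 0 = x"
      using e by (intro exp_terminal_always_left) (simp add: step_prob_def ab)
    then have "expected_payoff ?S x 0 nS ?S A 0 = ereal (x - e)"
      using e exp_cost_geometric[of e ?S A 0] by (simp add: expected_payoff_eq enn2ereal_ennreal)
    then show "x \<le> n 0 + e" using mina_deviation[OF geom[OF e], of 0] by (simp add: payoffs)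
  qed
  \<comment> \<open>The weight \<open>x\<close> equalises the prizes: the combined receipt is
    \<open>x\<close> on either escape and at most 0 otherwise.\<close>
  moreover have "x * m 0 + n 0 \<le> x"
  proof -
    interpret T: prob_space trail_space by (rule prob_space_trail)
    have cost: "exp_cost (\<lambda>i t. 0) Sm Sp 0 = 0" for Sm Sp by (simp add: exp_cost_def path_cost_def)
    have "m 0 = exp_terminal 0 1 mS B A 0" "n 0 = exp_terminal x 0 nS B A 0"
      unfolding m_def n_def game_value_def using cost by (simp_all add: ab)
    then have "x * m 0 + n 0 = (\<integral>\<omega>. x * terminal 0 1 mS (trail_path B A 0 \<omega>) + terminal x 0 nS (trail_path B A 0 \<omega>) \<partial>trail_space)"
      unfolding exp_terminal_def using integrable_terminal by simp
    also have "\<dots> \<le> (\<integral>\<omega>. x \<partial>trail_space)"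
    proof (intro integral_mono)
      fix \<omega>
      have "x * mS \<le> 0" using x_pos mS by (simp add: mult_le_0_iff)
      then show "x * terminal 0 1 mS (trail_path B A 0 \<omega>) + terminal x 0 nS (trail_path B A 0 \<omega>) \<le> x"
        using x_pos nS by (simp add: terminal_def)
    qed (use integrable_terminal in auto)
    finally show ?thesis by (simp add: T.prob_space)
  qed
  moreover have "x * 1 \<le> x * m 0" using x_pos \<open>1 \<le> m 0\<close> by (intro mult_left_mono) auto
  ultimately show False using x_pos by simp
qed

lemma all_positive: "ABMN_positive a b m n"
proof -
  obtain k where "0 < a k" using some_stake by blast
  then have pos: "0 < a i" for i
  proof (induction i rule: int_induct[where k = k])
    case (step1 i)
    then show ?case using positive_step[of i] by simp
  next
    case (step2 i)
    then show ?case using positive_step[of "i - 1"] by simp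
  qed
  show ?thesis
    unfolding ABMN_positive_def ABMN_def
  proof (intro conjI allI)
    fix i
    have "0 < b i \<and> (a i + b i)\<^sup>2 = b i * (m (i + 1) - m (i - 1)) \<and> (a i + b i)\<^sup>2 = a i * (n (i - 1) - n (i + 1))"
      using pos[of i] by (cases rule: site_cases[of i]) auto
    then show "0 < b i" "(a i + b i)\<^sup>2 = b i * (m (i + 1) - m (i - 1))"
      "(a i + b i)\<^sup>2 = a i * (n (i - 1) - n (i + 1))" by auto
    then show "(a i + b i) * (m i + a i) = a i * m (i + 1) + b i * m (i - 1)"
      "(a i + b i) * (n i + b i) = a i * n (i + 1) + b i * n (i - 1)"
      using site_equations[OF pos] by auto
  qed (use pos stakes_nonneg in auto)
qed

text \<open>The value \<open>m\<close> is the payoff both with terminal receipts \<open>(0, 1)\<close> and with its own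
  limits \<open>(mL, mR)\<close>; since the probability \<open>h k\<close> of escape to the right tends to \<open>1\<close> and \<open>0\<close>
  at the two ends, the two pairs agree. The same holds for \<open>n\<close>.\<close>

lemma standard: "ABMN_standard a b m n" "(n \<longlongrightarrow> x) at_bot"
proof -
  interpret ABMN_pos a b m n by unfold_locales (rule all_positive)
  obtain mL mR nL nR where l: "(m \<longlongrightarrow> mL) at_bot" "(m \<longlongrightarrow> mR) at_top"
    "(n \<longlongrightarrow> nL) at_bot" "(n \<longlongrightarrow> nR) at_top"
    by (rule limits) blast
  have "mL < mR" "nR < nL"
    using limit_bounds(1)[OF l(1), of 0] limit_bounds(2)[OF l(2), of 0]
      limit_bounds(3)[OF l(3), of 0] limit_bounds(4)[OF l(4), of 0] by auto
  define h where "h k = exp_terminal 0 1 0 B A k" for k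
  have h: "exp_terminal tL tR tS B A k = tL + (tR - tL) * h k" for tL tR tS k
    unfolding h_def by (rule diverges_exp_terminal[OF maxine_value(2)[OF l(1,2)]])
  have h01: "0 \<le> h k" "h k \<le> 1" for k
  proof -
    interpret T: prob_space trail_space by (rule prob_space_trail)
    show "0 \<le> h k" unfolding h_def exp_terminal_def
      by (rule Bochner_Integration.integral_nonneg) (simp add: terminal_def)
    have "h k \<le> (\<integral>\<omega>. 1 \<partial>trail_space)" unfolding h_def exp_terminal_def
      by (intro integral_mono integrable_terminal) (auto simp: terminal_def)
    then show "h k \<le> 1" by (simp add: T.prob_space)
  qed
  have m_val: "mL + (mR - mL) * h k - enn2real (exp_cost A B A k) = m k" for k
    using maxine_value(3)[OF l(1,2), of 0 k] by (simp add: game_value_def h)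
  have n_val: "nL + (nR - nL) * h k - enn2real (exp_cost B B A k) = n k" for k
    using mina_value(2)[OF l(3,4), of 0 k] by (simp add: game_value_def h)
  \<comment> \<open>The two representations of \<open>m k\<close> carry the same expected cost,
    which cancels.\<close>
  have "mL + (mR - mL - 1) * h k = 0" for k
    using m_val[of k] by (simp add: m_def game_value_def h algebra_simps)
  then have m_const: "((\<lambda>k. mL + (mR - mL - 1) * h k) \<longlongrightarrow> 0) F" for F by simp
  have "nL - x + (nR - nL + x) * h k = 0" for k
    using n_val[of k] by (simp add: n_def game_value_def h algebra_simps)
  then have n_const: "((\<lambda>k. nL - x + (nR - nL + x) * h k) \<longlongrightarrow> 0) F" for F by simp
  \<comment> \<open>Dropping the nonnegative cost gives
    \<open>m k \<le> mL + (mR - mL) * h k\<close>, so \<open>h\<close> is forced to 1 where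
    \<open>m\<close> tends to \<open>mR\<close>.\<close>
  have top: "(h \<longlongrightarrow> 1) at_top"
  proof (rule tendsto_sandwich)
    show "((\<lambda>k. 1 - (mR - m k) / (mR - mL)) \<longlongrightarrow> 1) at_top"
      using \<open>mL < mR\<close> by (auto intro!: tendsto_eq_intros l(2))
    have "1 - (mR - m k) / (mR - mL) \<le> h k" for k
    proof -
      have "(mR - mL) * (1 - h k) \<le> mR - m k"
        using m_val[of k] enn2real_nonneg[of "exp_cost A B A k"] by (simp add: algebra_simps)
      then show ?thesis using \<open>mL < mR\<close> by (simp add: field_simps)
    qed
    then show "\<forall>\<^sub>F k in at_top. 1 - (mR - m k) / (mR - mL) \<le> h k" by (intro always_eventually allI)
  qed (use h01 in auto)
  \<comment> \<open>Maxine's value bounds \<open>h\<close> only from below; the upper bound comes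
    from Mina's.\<close>
  have bot: "(h \<longlongrightarrow> 0) at_bot"
  proof (rule tendsto_sandwich[of "\<lambda>_. 0"])
    show "((\<lambda>k. (nL - n k) / (nL - nR)) \<longlongrightarrow> 0) at_bot"
      using \<open>nR < nL\<close> by (auto intro!: tendsto_eq_intros l(3))
    have "h k \<le> (nL - n k) / (nL - nR)" for k
    proof -
      have "(nL - nR) * h k \<le> nL - n k"
        using n_val[of k] enn2real_nonneg[of "exp_cost B B A k"] by (simp add: algebra_simps)
      then show ?thesis using \<open>nR < nL\<close> by (simp add: field_simps)
    qed
    then show "\<forall>\<^sub>F k in at_bot. h k \<le> (nL - n k) / (nL - nR)" by (intro always_eventually allI)
  qed (use h01 in auto)
  have lims: "((\<lambda>k. mL + (mR - mL - 1) * h k) \<longlongrightarrow> mL + (mR - mL - 1) * 0) at_bot"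
    "((\<lambda>k. mL + (mR - mL - 1) * h k) \<longlongrightarrow> mL + (mR - mL - 1) * 1) at_top"
    "((\<lambda>k. nL - x + (nR - nL + x) * h k) \<longlongrightarrow> nL - x + (nR - nL + x) * 0) at_bot"
    "((\<lambda>k. nL - x + (nR - nL + x) * h k) \<longlongrightarrow> nL - x + (nR - nL + x) * 1) at_top"
    by (intro tendsto_intros top bot)+
  have "mL = 0" "mR = 1" "nL = x" "nR = 0"
    using tendsto_unique[OF trivial_limit_at_bot_linorder lims(1) m_const]
      tendsto_unique[OF trivial_limit_at_top_linorder lims(2) m_const]
      tendsto_unique[OF trivial_limit_at_bot_linorder lims(3) n_const]
      tendsto_unique[OF trivial_limit_at_top_linorder lims(4) n_const] by auto
  then show "ABMN_standard a b m n" "(n \<longlongrightarrow> x) at_bot"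
    using l all_positive by (auto simp: ABMN_standard_def)
qed

end

text \<open>The parameter \<open>z\<close> of an equilibrium is the central ratio of its payoffs;
  uniqueness of the standard solution then identifies the stakes.\<close>

lemma TI_nash_set_eq:
  assumes "0 < x" "mS \<le> 0" "nS \<le> 0"
  shows "TI_nash_set 0 1 x 0 mS nS = {(\<lambda>i. (b_st z i, a_st z i)) | z. 0 < z \<and> Mcal z = x}"
proof (intro equalityI subsetI)
  fix f assume "f \<in> TI_nash_set 0 1 x 0 mS nS"
  then interpret E: TI_equilibrium "\<lambda>i. snd (f i)" "\<lambda>i. fst (f i)" x mS nS
    using assms by unfold_locales (auto simp: TI_nash_set_def)
  interpret ABMN_pos "\<lambda>i. snd (f i)" "\<lambda>i. fst (f i)" E.m E.n
    by unfold_locales (rule E.all_positive)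
  define z where "z = cratio E.m E.n 0"
  have z: "0 < z" unfolding z_def by (rule cratio_pos)
  note st = st_sol_eqI[OF E.standard(1) z_def[symmetric]]
  have "Mcal z = x"
    using tendsto_unique[OF _ n_st_tendsto_Mcal[OF z]] E.standard(2) st(4) by auto
  moreover have "f = (\<lambda>i. (b_st z i, a_st z i))" by (simp add: st)
  ultimately show "f \<in> {(\<lambda>i. (b_st z i, a_st z i)) | z. 0 < z \<and> Mcal z = x}" using z by blast
next
  fix f assume "f \<in> {(\<lambda>i. (b_st z i, a_st z i)) | z. 0 < z \<and> Mcal z = x}"
  then obtain z where z: "0 < z" "Mcal z = x" and f: "f = (\<lambda>i. (b_st z i, a_st z i))" by blast
  note st = st_sol_standard(1)[OF z(1), unfolded ABMN_standard_def]
  interpret ABMN_pos "a_st z" "b_st z" "m_st z" "n_st z" using st by unfold_locales simp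
  have "trail_nash 0 1 x 0 mS nS (\<lambda>i t. b_st z i) (\<lambda>i t. a_st z i)"
    using st n_st_tendsto_Mcal[OF z(1)] z(2) assms(2,3) by (intro nash) auto
  then show "f \<in> TI_nash_set 0 1 x 0 mS nS" by (simp add: TI_nash_set_def f)
qed

thm_deps TI_nash_set_eq lambda_const_pos

theorem mainTheorem15:
  fixes x mS nS :: real and X Y :: "real set"
  assumes "mS \<le> 0" and "nS \<le> 0"
    and "lambda_const \<le> x" and "x \<le> 1 / lambda_const"
  defines "X \<equiv> {z. 0 < z \<and> Mcal z = x}"
  defines "Y \<equiv> X \<inter> {1/3<..3}"
  shows "X = (\<Union>k. s_iter k ` Y) \<and>
    TI_nash_set 0 1 x 0 mS nS = {(\<lambda>i. (b_st z i, a_st z i)) | z. z \<in> X} \<and>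
    TI_nash_set 0 1 x 0 mS nS = {(\<lambda>i. (b_st y (i + j), a_st y (i + j))) | y j. y \<in> Y}"
proof -
  \<comment> \<open>\<open>X\<close> is a union of full orbits, because \<open>Mcal\<close> is
    unchanged by shifts.\<close>
  have X_iter: "s_iter k z \<in> X" if "z \<in> X" for k z
    using that s_iter_pos[of z k] st_sol_shift(3)[of z k] by (simp add: X_def)
  have X_eq: "X = (\<Union>k. s_iter k ` Y)"
  proof (intro equalityI subsetI)
    fix z assume z: "z \<in> X"
    then have "0 < z" by (simp add: X_def)
    then obtain j where "s_iter j z \<in> {1/3<..3}" by (rule s_iter_fundamental_domain)
    then have "s_iter j z \<in> Y" using X_iter[OF z] by (simp add: Y_def)
    moreover have "z = s_iter (- j) (s_iter j z)" using s_iter_add[OF \<open>0 < z\<close>, of "- j" j] by simp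
    ultimately show "z \<in> (\<Union>k. s_iter k ` Y)" by blast
  qed (use X_iter in \<open>auto simp: Y_def\<close>)
  have nash: "TI_nash_set 0 1 x 0 mS nS = {(\<lambda>i. (b_st z i, a_st z i)) | z. z \<in> X}"
    using TI_nash_set_eq[of x mS nS] lambda_const_pos assms by (simp add: X_def)
  have "{(\<lambda>i. (b_st z i, a_st z i)) | z. z \<in> X} = {(\<lambda>i. (b_st (s_iter j y) i, a_st (s_iter j y) i)) | y j. y \<in> Y}"
    unfolding X_eq by blast
  also have "\<dots> = {(\<lambda>i. (b_st y (i + j), a_st y (i + j))) | y j. y \<in> Y}"
  proof -
    \<comment> \<open>Moving along the orbit by \<open>j\<close> is the same as translating the
      stakes by \<open>j\<close>.\<close>
    have "(\<lambda>i. (b_st (s_iter j y) i, a_st (s_iter j y) i)) = (\<lambda>i. (b_st y (i + j), a_st y (i + j)))"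
      if "y \<in> Y" for y j
      using that st_sol_shift(1,2)[of y j] by (simp add: X_def Y_def)
    then show ?thesis by (intro Collect_cong ex_cong1) auto
  qed
  finally show ?thesis using X_eq nash by simp
qed

end
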